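(* Every face of a Bruhat interval polytope for $G/P_J$ is a Bruhat interval polytope for $G/P_J$. That is, if $u\leq v$ in $W$ with $v\in W^J$ and $F$ is a (nonempty) face of $\mathsf{Q}^J_{u,v}$, then there exist $a\leq b$ in $W$ with $b\in W^J$ such that $F=\mathsf{Q}^J_{a,b}$.
   Context: $G$ is a semisimple, simply connected linear algebraic group over $\mathbb{C}$, split over $\mathbb{R}$, with split maximal torus $T$, Borel subgroup $B\supset T$, simple roots indexed by $I$, fundamental weights $\omega_i$ ($i\in I$), and Weyl group $W$ with simple reflections $s_i$ and Bruhat order $\leq$; $\mathfrak{t}^*_{\mathbb{R}}$ is the real dual of the Lie algebra of $T$, on which $W$ acts. For $J\subset I$, $W_J=\langle s_j:j\in J\rangle$, $P_J\supset B$ is the corresponding parabolic subgroup, $W^J$ is the set of minimal-length coset representatives of $W/W_J$, and $\rho_J=\sum_{i\in I\setminus J}\omega_i$ (whose stabilizer in $W$ is $W_J$). For $u\leq v$ in $W$ with $v\in W^J$, the Bruhat interval polytope for $G/P_J$ is $\mathsf{Q}^J_{u,v}=\mathrm{Conv}\{z\cdot\rho_J\mid u\leq z\leq v\}\subset\mathfrak{t}^*_{\mathbb{R}}$. *)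

theory Defs
  imports "HOL-Analysis.Analysis"
begin

text \<open>
  The group \<open>G\<close> enters only through its root system \<open>\<Phi>\<close> with respect to \<open>T\<close>, together with
  the simple roots \<open>\<Delta>\<close> determined by \<open>B\<close>: split semisimple simply connected groups
  correspond, up to isomorphism, to reduced crystallographic root systems.  The space
  \<open>\<tt>\<^sup>*\<^sub>\<real>\<close> is \<open>span \<Phi>\<close>, with a Weyl group invariant inner product inherited from an
  ambient Euclidean space.  The roots are not required to span the ambient space, so that
  the trivial group (\<open>\<Phi> = {}\<close>) is included.  The index set \<open>I\<close> is \<open>\<Delta>\<close> itself, each simple
  root being its own index; thus \<open>J \<subset> I\<close> becomes \<open>J \<subseteq> \<Delta>\<close>.
\<close>

definition root_pairing :: "'a::euclidean_space \<Rightarrow> 'a \<Rightarrow> real" where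
  "root_pairing x \<beta> = 2 * (x \<bullet> \<beta>) / (\<beta> \<bullet> \<beta>)"  \<comment> \<open>the value of the coroot of \<open>\<beta>\<close> at \<open>x\<close>\<close>

definition reflection :: "'a::euclidean_space \<Rightarrow> 'a \<Rightarrow> 'a" where
  "reflection \<beta> = (\<lambda>x. x - root_pairing x \<beta> *\<^sub>R \<beta>)"

definition root_system :: "'a::euclidean_space set \<Rightarrow> bool" where
  "root_system \<Phi> \<longleftrightarrow>
     finite \<Phi> \<and> 0 \<notin> \<Phi> \<and>
     (\<forall>\<beta>\<in>\<Phi>. reflection \<beta> ` \<Phi> = \<Phi>) \<and>
     (\<forall>\<beta>\<in>\<Phi>. \<forall>\<gamma>\<in>\<Phi>. root_pairing \<gamma> \<beta> \<in> \<int>) \<and>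
     (\<forall>\<beta>\<in>\<Phi>. \<forall>c::real. c *\<^sub>R \<beta> \<in> \<Phi> \<longrightarrow> c = 1 \<or> c = -1)"

definition simple_roots :: "'a::euclidean_space set \<Rightarrow> 'a set \<Rightarrow> bool" where
  "simple_roots \<Phi> \<Delta> \<longleftrightarrow>
     \<Delta> \<subseteq> \<Phi> \<and> independent \<Delta> \<and>
     (\<forall>\<beta>\<in>\<Phi>. \<exists>c::'a \<Rightarrow> int.
        \<beta> = (\<Sum>\<alpha>\<in>\<Delta>. of_int (c \<alpha>) *\<^sub>R \<alpha>) \<and> ((\<forall>\<alpha>\<in>\<Delta>. 0 \<le> c \<alpha>) \<or> (\<forall>\<alpha>\<in>\<Delta>. c \<alpha> \<le> 0)))"

text \<open>
  The group generated by the reflections in the vectors of \<open>A\<close>, acting by linear maps.  As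
  reflections are involutions, closure under inverses is automatic.
\<close>
inductive_set reflection_group :: "'a::euclidean_space set \<Rightarrow> ('a \<Rightarrow> 'a) set"
  for A :: "'a set" where
    one: "id \<in> reflection_group A"
  | step: "\<lbrakk>\<beta> \<in> A; w \<in> reflection_group A\<rbrakk> \<Longrightarrow> reflection \<beta> \<circ> w \<in> reflection_group A"

definition weyl_group :: "'a::euclidean_space set \<Rightarrow> ('a \<Rightarrow> 'a) set" where
  "weyl_group \<Phi> = reflection_group \<Phi>"

definition parabolic_weyl_group :: "'a::euclidean_space set \<Rightarrow> ('a \<Rightarrow> 'a) set" where
  "parabolic_weyl_group J = reflection_group J"  \<comment> \<open>\<open>W\<^sub>J\<close>, for \<open>J \<subseteq> \<Delta>\<close>\<close>

definition word_product :: "'a::euclidean_space list \<Rightarrow> 'a \<Rightarrow> 'a" where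
  "word_product \<alpha>s = foldr (\<lambda>\<alpha> w. reflection \<alpha> \<circ> w) \<alpha>s id"

definition weyl_length :: "'a::euclidean_space set \<Rightarrow> ('a \<Rightarrow> 'a) \<Rightarrow> nat" where
  "weyl_length \<Delta> w =
     (LEAST n. \<exists>\<alpha>s. set \<alpha>s \<subseteq> \<Delta> \<and> length \<alpha>s = n \<and> word_product \<alpha>s = w)"

text \<open>
  The reflections of the Coxeter group (the conjugates of the simple ones) are exactly the
  reflections in the roots.
\<close>
definition bruhat_step ::
  "'a::euclidean_space set \<Rightarrow> 'a set \<Rightarrow> ('a \<Rightarrow> 'a) \<Rightarrow> ('a \<Rightarrow> 'a) \<Rightarrow> bool" where
  "bruhat_step \<Phi> \<Delta> u v \<longleftrightarrow>
     u \<in> weyl_group \<Phi> \<and>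
     (\<exists>\<beta>\<in>\<Phi>. v = u \<circ> reflection \<beta>) \<and> weyl_length \<Delta> u < weyl_length \<Delta> v"

definition bruhat_le ::
  "'a::euclidean_space set \<Rightarrow> 'a set \<Rightarrow> ('a \<Rightarrow> 'a) \<Rightarrow> ('a \<Rightarrow> 'a) \<Rightarrow> bool" where
  "bruhat_le \<Phi> \<Delta> u v \<longleftrightarrow>
     u \<in> weyl_group \<Phi> \<and> v \<in> weyl_group \<Phi> \<and> (bruhat_step \<Phi> \<Delta>)\<^sup>*\<^sup>* u v"

definition min_coset_reps ::
  "'a::euclidean_space set \<Rightarrow> 'a set \<Rightarrow> 'a set \<Rightarrow> ('a \<Rightarrow> 'a) set" where
  "min_coset_reps \<Phi> \<Delta> J =
     {w \<in> weyl_group \<Phi>. \<forall>x\<in>parabolic_weyl_group J. weyl_length \<Delta> w \<le> weyl_length \<Delta> (w \<circ> x)}"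

definition fundamental_weight :: "'a::euclidean_space set \<Rightarrow> 'a \<Rightarrow> 'a" where
  "fundamental_weight \<Delta> \<alpha> =
     (THE \<omega>. \<omega> \<in> span \<Delta> \<and> (\<forall>\<alpha>'\<in>\<Delta>. root_pairing \<omega> \<alpha>' = (if \<alpha>' = \<alpha> then 1 else 0)))"

lemma ex1_fundamental_weight:
  fixes \<Delta> :: "'a::euclidean_space set"
  assumes "independent \<Delta>"
  shows "\<exists>!\<omega>. \<omega> \<in> span \<Delta> \<and> (\<forall>\<alpha>'\<in>\<Delta>. root_pairing \<omega> \<alpha>' = (if \<alpha>' = \<alpha> then 1 else 0))"
proof -
  have nz: "\<alpha>' \<bullet> \<alpha>' \<noteq> 0" if "\<alpha>' \<in> \<Delta>" for \<alpha>'
    using that assms dependent_zero by auto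
  obtain f :: "'a \<Rightarrow> real" where f: "linear f"
    "\<forall>\<alpha>'\<in>\<Delta>. f \<alpha>' = (if \<alpha>' = \<alpha> then (\<alpha> \<bullet> \<alpha>) / 2 else 0)"
    using linear_independent_extend[OF assms, of "\<lambda>\<alpha>'. if \<alpha>' = \<alpha> then (\<alpha> \<bullet> \<alpha>) / 2 else 0"]
    by blast
  obtain y z where yz: "y \<in> span \<Delta>" "\<And>w. w \<in> span \<Delta> \<Longrightarrow> orthogonal z w" "adjoint f 1 = y + z"
    using orthogonal_subspace_decomp_exists[of \<Delta> "adjoint f 1"] by blast
  have y: "y \<bullet> \<alpha>' = f \<alpha>'" if "\<alpha>' \<in> \<Delta>" for \<alpha>'
  proof -
    have "f \<alpha>' = adjoint f 1 \<bullet> \<alpha>'"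
      using adjoint_clauses(2)[OF f(1), of 1 \<alpha>'] by simp
    moreover have "z \<bullet> \<alpha>' = 0"
      using yz(2)[OF span_base[OF that]] by (simp add: orthogonal_def)
    ultimately show ?thesis by (simp add: yz(3) inner_add_left)
  qed
  show ?thesis
  proof (rule ex1I[of _ y])
    show "y \<in> span \<Delta> \<and> (\<forall>\<alpha>'\<in>\<Delta>. root_pairing y \<alpha>' = (if \<alpha>' = \<alpha> then 1 else 0))"
      using yz(1) y f(2) nz by (auto simp: root_pairing_def)
  next
    fix x assume x: "x \<in> span \<Delta> \<and> (\<forall>\<alpha>'\<in>\<Delta>. root_pairing x \<alpha>' = (if \<alpha>' = \<alpha> then 1 else 0))"
    have *: "orthogonal (x - y) \<alpha>'" if "\<alpha>' \<in> \<Delta>" for \<alpha>'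
    proof -
      have "root_pairing x \<alpha>' = root_pairing y \<alpha>'"
        using x y[OF that] f(2) nz that by (auto simp: root_pairing_def)
      then show ?thesis
        using nz[OF that] by (simp add: root_pairing_def orthogonal_def inner_diff_left)
    qed
    have "x - y \<in> span \<Delta>"
      using x yz(1) by (simp add: span_diff)
    then have "orthogonal (x - y) (x - y)"
      using orthogonal_to_span * by blast
    then show "x = y" by (simp add: orthogonal_self)
  qed
qed

definition parabolic_rho :: "'a::euclidean_space set \<Rightarrow> 'a set \<Rightarrow> 'a" where
  "parabolic_rho \<Delta> J = (\<Sum>\<alpha>\<in>\<Delta> - J. fundamental_weight \<Delta> \<alpha>)"

definition bruhat_interval_polytope ::
  "'a::euclidean_space set \<Rightarrow> 'a set \<Rightarrow> 'a set \<Rightarrow> ('a \<Rightarrow> 'a) \<Rightarrow> ('a \<Rightarrow> 'a) \<Rightarrow> 'a set" where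
  "bruhat_interval_polytope \<Phi> \<Delta> J u v =
     convex hull {z (parabolic_rho \<Delta> J) |z. bruhat_le \<Phi> \<Delta> u z \<and> bruhat_le \<Phi> \<Delta> z v}"

end

theory Submission
  imports Defs
begin

text \<open>
  Fix a linear functional \<open>\<eta>\<close> and a Bruhat interval \<open>[u, v]\<close>.  For generic \<open>\<eta>\<close>, only one
  \<open>p \<in> [u, v]\<close> is locally maximal along the edges of the Bruhat graph: in the left regular
  representation of the Hecke algebra, split \<open>T\<^bsub>w\<^sub>0\<^esub> = T\<^bsub>y\<^esub> T\<^bsub>x\<^esub>\<close>, where \<open>x \<eta>\<close> is antidominant.  Every
  local maximum contributes 1 to the leading coefficient of the R-polynomial of \<open>(u, v)\<close>, which
  equals 1.  In particular, the maximizer of \<open>\<eta> (z \<mu>)\<close> can be chosen independently of the dominant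
  weight \<open>\<mu>\<close>.

  For arbitrary \<open>\<eta>\<close>, the elements maximizing \<open>\<eta> (z \<rho>)\<close> have a least element \<open>a\<close> and a greatest
  element \<open>b\<close>, since minimal and maximal elements are local maxima of the perturbations
  \<open>\<eta> \<plusminus> \<epsilon> \<rho>\<close>.  A functional that attains its maximum at both ends of an interval is constant on it,
  so they form the interval \<open>[a, b]\<close>, and perturbing \<open>\<eta>\<close> shows that the face of \<open>\<eta>\<close> is the convex
  hull of \<open>z \<rho>\<^sub>J\<close> for \<open>z \<in> [a, b]\<close>.  Finally, right descents of \<open>b\<close> in \<open>J\<close> are removed one by one.
\<close>

subsection \<open>Perturbation and convex hulls\<close>

text \<open>Uniqueness of local maxima rests on positivity. With the normalization T^2 = 1 + q T,
  where q stands for the usual q^(1/2) - q^(-1/2), Hecke coefficients are natural numbers, so the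
  contributions of two local maxima add up and cannot cancel. Being a local maximum involves no
  weight: comparing the lengths of p and s_\<beta> p decides the sign of p \<mu> at \<beta> for all
  dominant \<mu> simultaneously, strictly if \<mu> is regular. This lets one element serve every
  weight. The obstacle is that rho_J may be singular. Several z share one vertex z rho_J, and the
  set maximizing \<eta> (z rho_J) may be strictly larger than the one maximizing \<eta> (z rho). The
  interval is therefore found at the regular weight rho, and only its convex hull is compared with
  the face at rho_J. Uniqueness alone shows just that the maximizers at rho lie between a and b;
  that all of [a, b] maximizes needs a separate induction, based on the lifting property.\<close>

lemma eventually_less_perturb:
  fixes a b k l :: real
  assumes "a < b"
  shows "eventually (\<lambda>\<epsilon>. a + \<epsilon> * k < b + \<epsilon> * l) (at_right 0)"
proof -
  have "((\<lambda>\<epsilon>. b + \<epsilon> * l - (a + \<epsilon> * k)) \<longlongrightarrow> b + 0 * l - (a + 0 * k)) (at_right 0)"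
    by (intro tendsto_intros)
  then have "eventually (\<lambda>\<epsilon>. 0 < b + \<epsilon> * l - (a + \<epsilon> * k)) (at_right 0)"
    using assms by (intro order_tendstoD(1)) auto
  then show ?thesis by (rule eventually_mono) simp
qed

text \<open>The filter \<open>at_right 0\<close> stands for all sufficiently small positive
  \<epsilon>; it lets finitely many conditions be imposed together without naming a bound.\<close>

lemma eventually_nonzero_perturb:
  fixes a k :: real
  assumes "a \<noteq> 0 \<or> k \<noteq> 0"
  shows "eventually (\<lambda>\<epsilon>. a + \<epsilon> * k \<noteq> 0) (at_right 0)"
proof (cases "a = 0")
  case True
  then show ?thesis
    using assms eventually_at_right_less[of 0] by (auto elim: eventually_mono)
next
  case False
  then consider "a < 0" | "0 < a" by linarith
  then show ?thesis
    using eventually_less_perturb[of a 0 k 0] eventually_less_perturb[of 0 a 0 k]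
    by cases (auto elim: eventually_mono)
qed

lemma le_if_eventually_le_perturb:
  fixes a b k l :: real
  assumes "eventually (\<lambda>\<epsilon>. a + \<epsilon> * k \<le> b + \<epsilon> * l) (at_right 0)"
  shows "a \<le> b"
proof (rule ccontr)
  assume "\<not> a \<le> b"
  then have "eventually (\<lambda>\<epsilon>. b + \<epsilon> * l < a + \<epsilon> * k) (at_right 0)"
    by (intro eventually_less_perturb) simp
  with assms have "eventually (\<lambda>\<epsilon>::real. False) (at_right 0)"
    by eventually_elim simp
  then show False by simp
qed

text \<open>Faces of a polytope are exposed, and a face of a hull of points is the hull of some of
  them. This turns a face into a maximization over \<open>S\<close>; the improper face fits in,
  since \<open>\<eta>\<close> = 0 is not excluded.\<close>

lemma face_of_convex_hull_finite_exposed: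
  fixes S :: "'a::euclidean_space set"
  assumes "finite S" "F face_of convex hull S" "F \<noteq> {}"
  obtains \<eta> m where "\<And>x. x \<in> S \<Longrightarrow> \<eta> \<bullet> x \<le> m" "F = convex hull {x\<in>S. \<eta> \<bullet> x = m}"
    "{x\<in>S. \<eta> \<bullet> x = m} \<noteq> {}"
proof -
  have "polyhedron (convex hull S)"
    using assms(1) by (intro polytope_imp_polyhedron) (auto simp: polytope_def)
  from exposed_face_of_polyhedron[OF this] have "F exposed_face_of convex hull S"
    using assms(2) by simp
  then have "\<exists>\<eta> m. convex hull S \<subseteq> {x. \<eta> \<bullet> x \<le> m} \<and> F = convex hull S \<inter> {x. \<eta> \<bullet> x = m}"
    unfolding exposed_face_of_def by (rule conjunct2)
  then obtain \<eta> m where e: "convex hull S \<subseteq> {x. \<eta> \<bullet> x \<le> m}"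
    "F = convex hull S \<inter> {x. \<eta> \<bullet> x = m}"
    by (elim exE conjE)
  obtain S' where S': "S' \<subseteq> S" "F = convex hull S'"
    using face_of_convex_hull_subset[OF finite_imp_compact[OF assms(1)] assms(2)] by blast
  have "S' \<subseteq> F" unfolding S'(2) by (rule hull_subset)
  then have sub: "S' \<subseteq> {x\<in>S. \<eta> \<bullet> x = m}" using S'(1) e(2) by blast
  have "S \<subseteq> convex hull S" by (rule hull_subset)
  then have "{x\<in>S. \<eta> \<bullet> x = m} \<subseteq> F" using e(2) by blast
  moreover have "convex F" using face_of_imp_convex[OF assms(2)] by simp
  ultimately have "convex hull {x\<in>S. \<eta> \<bullet> x = m} \<subseteq> F" by (rule hull_minimal)
  moreover have "F \<subseteq> convex hull {x\<in>S. \<eta> \<bullet> x = m}"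
    unfolding S'(2) by (rule hull_mono[OF sub])
  ultimately have F: "F = convex hull {x\<in>S. \<eta> \<bullet> x = m}" by (rule antisym[rotated])
  show ?thesis
  proof (rule that[OF _ F])
    show "\<eta> \<bullet> x \<le> m" if "x \<in> S" for x
      using that e(1) \<open>S \<subseteq> convex hull S\<close> by blast
    show "{x\<in>S. \<eta> \<bullet> x = m} \<noteq> {}"
      using sub assms(3) S'(2) by fastforce
  qed
qed

subsection \<open>Reflections and the length function\<close>

lemma orthogonal_transformation_reflection: "orthogonal_transformation (reflection \<beta>)"
proof -
  have "linear (reflection \<beta>)"
    by (auto intro!: linearI simp: reflection_def root_pairing_def inner_add_left
        algebra_simps add_divide_distrib)
  moreover have "reflection \<beta> x \<bullet> reflection \<beta> y = x \<bullet> y" for x y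
  proof (cases "\<beta> = 0")
    case False
    have "reflection \<beta> x \<bullet> reflection \<beta> y = x \<bullet> y - root_pairing y \<beta> * (x \<bullet> \<beta>)
        - root_pairing x \<beta> * (y \<bullet> \<beta>) + root_pairing x \<beta> * root_pairing y \<beta> * (\<beta> \<bullet> \<beta>)"
      by (simp add: reflection_def inner_diff_left inner_diff_right inner_commute[of \<beta> y]
          algebra_simps)
    also have "\<dots> = x \<bullet> y"
      using False by (simp add: root_pairing_def)
    finally show ?thesis .
  qed (simp add: reflection_def)
  ultimately show ?thesis
    by (simp add: orthogonal_transformation_def)
qed

lemma reflection_self: "reflection \<beta> \<beta> = - \<beta>"
  by (cases "\<beta> = 0") (simp_all add: reflection_def root_pairing_def algebra_simps scaleR_2)

lemma reflection_reflection [simp]: "reflection \<beta> (reflection \<beta> x) = x"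
  by (cases "\<beta> = 0")
    (simp_all add: reflection_def root_pairing_def inner_diff_left field_simps)

lemma reflection_comp_reflection [simp]:
  "reflection \<beta> \<circ> reflection \<beta> = id" "reflection \<beta> \<circ> (reflection \<beta> \<circ> w) = w"
  "w \<circ> reflection \<beta> \<circ> reflection \<beta> = w"
  by (auto simp: fun_eq_iff)

lemma reflection_minus: "reflection (- \<beta>) = reflection \<beta>"
  by (simp add: reflection_def root_pairing_def fun_eq_iff)

lemma reflection_conj:
  assumes "orthogonal_transformation w"
  shows "w \<circ> reflection \<beta> = reflection (w \<beta>) \<circ> w"
proof -
  have "linear w" "\<And>x y. w x \<bullet> w y = x \<bullet> y"
    using assms by (auto simp: orthogonal_transformation_def)
  then show ?thesis
    by (simp add: fun_eq_iff reflection_def root_pairing_def linear_diff linear_scale)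
qed

lemma inner_reflection:
  "x \<bullet> reflection \<beta> y = x \<bullet> y - root_pairing y \<beta> * (x \<bullet> \<beta>)"
  by (simp add: reflection_def inner_diff_right)

lemma inner_reflection_left: "reflection \<beta> x \<bullet> y = x \<bullet> reflection \<beta> y"
  by (simp add: reflection_def root_pairing_def inner_diff_right inner_diff_left inner_commute)

lemma word_product_simps [simp]:
  "word_product [] = id"
  "word_product (\<alpha> # \<alpha>s) = reflection \<alpha> \<circ> word_product \<alpha>s"
  "word_product (\<alpha>s @ \<beta>s) = word_product \<alpha>s \<circ> word_product \<beta>s"
proof -
  show "word_product [] = id"
    and "word_product (\<alpha> # \<alpha>s) = reflection \<alpha> \<circ> word_product \<alpha>s"
    by (simp_all add: word_product_def)
  show "word_product (\<alpha>s @ \<beta>s) = word_product \<alpha>s \<circ> word_product \<beta>s"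
    by (induction \<alpha>s) (simp_all add: word_product_def o_assoc)
qed

lemma orthogonal_transformation_word_product: "orthogonal_transformation (word_product \<alpha>s)"
proof (induction \<alpha>s)
  case Nil
  then show ?case by (simp add: id_def)
next
  case (Cons \<alpha> \<alpha>s)
  show ?case
    unfolding word_product_simps
    by (rule orthogonal_transformation_compose[OF orthogonal_transformation_reflection Cons])
qed

lemma reflection_group_eq_words:
  "reflection_group A = word_product ` {\<alpha>s. set \<alpha>s \<subseteq> A}"
proof
  show "reflection_group A \<subseteq> word_product ` {\<alpha>s. set \<alpha>s \<subseteq> A}"
  proof
    fix w assume "w \<in> reflection_group A"
    then show "w \<in> word_product ` {\<alpha>s. set \<alpha>s \<subseteq> A}"
    proof induction
      case one
      show ?case by (rule image_eqI[of _ _ "[]"]) simp_all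
    next
      case (step \<beta> w)
      then obtain \<alpha>s where "set \<alpha>s \<subseteq> A" "w = word_product \<alpha>s" by auto
      with step(1) show ?case by (intro image_eqI[of _ _ "\<beta> # \<alpha>s"]) simp_all
    qed
  qed
  have "word_product \<alpha>s \<in> reflection_group A" if "set \<alpha>s \<subseteq> A" for \<alpha>s
    using that by (induction \<alpha>s) (simp_all add: reflection_group.intros)
  then show "word_product ` {\<alpha>s. set \<alpha>s \<subseteq> A} \<subseteq> reflection_group A" by auto
qed

lemma reflection_group_comp:
  assumes "v \<in> reflection_group A" "w \<in> reflection_group A"
  shows "v \<circ> w \<in> reflection_group A"
  using assms by (induction) (simp_all add: reflection_group.step o_assoc[symmetric])

lemma reflection_group_reflection: "\<beta> \<in> A \<Longrightarrow> reflection \<beta> \<in> reflection_group A"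
  using reflection_group.step[OF _ reflection_group.one] by simp

lemma reflection_group_orthogonal:
  "w \<in> reflection_group A \<Longrightarrow> orthogonal_transformation w"
  by (auto simp: reflection_group_eq_words orthogonal_transformation_word_product)

lemma reflection_group_mono: "A \<subseteq> B \<Longrightarrow> reflection_group A \<subseteq> reflection_group B"
  by (auto simp: reflection_group_eq_words)

section \<open>Positive roots of a based root system\<close>

locale based_root_system =
  fixes \<Phi> \<Delta> :: "'a::euclidean_space set"
  assumes root_system: "root_system \<Phi>" and simple_roots: "simple_roots \<Phi> \<Delta>"
begin

abbreviation "W \<equiv> weyl_group \<Phi>"
abbreviation "len \<equiv> weyl_length \<Delta>"
abbreviation "rho \<equiv> parabolic_rho \<Delta> {}"

text \<open>Positivity is tested by the single functional \<open>rho\<close>;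
  \<open>pos_expansion\<close> and \<open>root_pos_or_neg\<close> show that this agrees with the
  signs of the coefficients.\<close>

definition pos :: "'a \<Rightarrow> bool" where
  "pos \<beta> \<longleftrightarrow> \<beta> \<in> \<Phi> \<and> 0 < rho \<bullet> \<beta>"

definition dominant :: "'a \<Rightarrow> bool" where
  "dominant \<mu> \<longleftrightarrow> (\<forall>\<alpha>\<in>\<Delta>. 0 \<le> \<mu> \<bullet> \<alpha>)"

lemma finite_roots: "finite \<Phi>"
  and root_nonzero: "\<beta> \<in> \<Phi> \<Longrightarrow> \<beta> \<noteq> 0"
  and reflection_roots: "\<beta> \<in> \<Phi> \<Longrightarrow> reflection \<beta> ` \<Phi> = \<Phi>"
  and simple_subset: "\<Delta> \<subseteq> \<Phi>"
  and independent_simple: "independent \<Delta>"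
  using root_system simple_roots by (auto simp: root_system_def simple_roots_def)

lemma finite_simple: "finite \<Delta>"
  using finite_roots simple_subset finite_subset by blast

lemma root_inner_pos: "\<beta> \<in> \<Phi> \<Longrightarrow> 0 < \<beta> \<bullet> \<beta>"
  using root_nonzero by auto

lemma root_minus: "\<beta> \<in> \<Phi> \<Longrightarrow> - \<beta> \<in> \<Phi>"
  using reflection_roots[of \<beta>] reflection_self[of \<beta>] by force

lemma root_expansion:
  assumes "\<beta> \<in> \<Phi>"
  obtains c :: "'a \<Rightarrow> real" where "\<beta> = (\<Sum>\<alpha>\<in>\<Delta>. c \<alpha> *\<^sub>R \<alpha>)"
    "(\<forall>\<alpha>\<in>\<Delta>. 0 \<le> c \<alpha>) \<or> (\<forall>\<alpha>\<in>\<Delta>. c \<alpha> \<le> 0)"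
proof -
  obtain c :: "'a \<Rightarrow> int" where "\<beta> = (\<Sum>\<alpha>\<in>\<Delta>. of_int (c \<alpha>) *\<^sub>R \<alpha>)"
    "(\<forall>\<alpha>\<in>\<Delta>. 0 \<le> c \<alpha>) \<or> (\<forall>\<alpha>\<in>\<Delta>. c \<alpha> \<le> 0)"
    using assms simple_roots unfolding simple_roots_def by metis
  then show ?thesis by (intro that[of "\<lambda>\<alpha>. of_int (c \<alpha>)"]) auto
qed

lemma fundamental_weight_inner:
  assumes "\<alpha> \<in> \<Delta>"
  shows "fundamental_weight \<Delta> \<gamma> \<bullet> \<alpha> = (if \<alpha> = \<gamma> then (\<alpha> \<bullet> \<alpha>) / 2 else 0)"
proof -
  have "root_pairing (fundamental_weight \<Delta> \<gamma>) \<alpha> = (if \<alpha> = \<gamma> then 1 else 0)"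
    using theI'[OF ex1_fundamental_weight[OF independent_simple, of \<gamma>]] assms
    unfolding fundamental_weight_def by blast
  moreover have "\<alpha> \<bullet> \<alpha> \<noteq> 0"
    using assms root_inner_pos simple_subset by force
  ultimately show ?thesis
    by (auto simp: root_pairing_def field_simps split: if_splits)
qed

lemma parabolic_rho_inner:
  assumes "\<alpha> \<in> \<Delta>"
  shows "parabolic_rho \<Delta> J \<bullet> \<alpha> = (if \<alpha> \<in> J then 0 else (\<alpha> \<bullet> \<alpha>) / 2)"
proof -
  have "parabolic_rho \<Delta> J \<bullet> \<alpha> = (\<Sum>\<gamma>\<in>\<Delta> - J. if \<alpha> = \<gamma> then (\<alpha> \<bullet> \<alpha>) / 2 else 0)"
    using assms by (simp add: parabolic_rho_def inner_sum_left fundamental_weight_inner)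
  then show ?thesis
    using assms finite_simple by simp
qed

lemma rho_simple: "\<alpha> \<in> \<Delta> \<Longrightarrow> 0 < rho \<bullet> \<alpha>"
  using root_inner_pos simple_subset by (auto simp: parabolic_rho_inner)

lemma dominant_parabolic_rho: "dominant (parabolic_rho \<Delta> J)"
  by (simp add: dominant_def parabolic_rho_inner)

lemma pos_simple: "\<alpha> \<in> \<Delta> \<Longrightarrow> pos \<alpha>"
  using rho_simple simple_subset by (auto simp: pos_def)

lemma pos_root: "pos \<beta> \<Longrightarrow> \<beta> \<in> \<Phi>"
  by (simp add: pos_def)

lemma pos_expansion:
  assumes "pos \<beta>"
  obtains c :: "'a \<Rightarrow> real" where "\<beta> = (\<Sum>\<alpha>\<in>\<Delta>. c \<alpha> *\<^sub>R \<alpha>)" "\<And>\<alpha>. \<alpha> \<in> \<Delta> \<Longrightarrow> 0 \<le> c \<alpha>"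
proof -
  obtain c where c: "\<beta> = (\<Sum>\<alpha>\<in>\<Delta>. c \<alpha> *\<^sub>R \<alpha>)"
    "(\<forall>\<alpha>\<in>\<Delta>. 0 \<le> c \<alpha>) \<or> (\<forall>\<alpha>\<in>\<Delta>. c \<alpha> \<le> 0)"
    using root_expansion pos_root[OF assms] by metis
  have "\<not> (\<forall>\<alpha>\<in>\<Delta>. c \<alpha> \<le> 0)"
  proof
    assume "\<forall>\<alpha>\<in>\<Delta>. c \<alpha> \<le> 0"
    then have "rho \<bullet> \<beta> \<le> 0"
      unfolding c(1) inner_sum_right
      by (auto intro!: sum_nonpos mult_nonpos_nonneg less_imp_le[OF rho_simple])
    with assms show False by (simp add: pos_def)
  qed
  with c that show ?thesis by blast
qed

lemma dominant_pos: "dominant \<mu> \<Longrightarrow> pos \<beta> \<Longrightarrow> 0 \<le> \<mu> \<bullet> \<beta>"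
  by (erule pos_expansion) (auto simp: dominant_def inner_sum_right intro!: sum_nonneg)

text \<open>Coefficients of one sign cannot cancel: if \<open>rho\<close> vanished on \<beta>, every
  coefficient of \<beta> would be 0.\<close>

lemma root_pos_or_neg:
  assumes "\<beta> \<in> \<Phi>"
  shows "pos \<beta> \<or> pos (- \<beta>)"
proof -
  obtain c where c: "\<beta> = (\<Sum>\<alpha>\<in>\<Delta>. c \<alpha> *\<^sub>R \<alpha>)"
    "(\<forall>\<alpha>\<in>\<Delta>. 0 \<le> c \<alpha>) \<or> (\<forall>\<alpha>\<in>\<Delta>. c \<alpha> \<le> 0)"
    using root_expansion assms by metis
  have "rho \<bullet> \<beta> \<noteq> 0"
  proof
    assume "rho \<bullet> \<beta> = 0"
    then have 0: "(\<Sum>\<alpha>\<in>\<Delta>. c \<alpha> * (rho \<bullet> \<alpha>)) = 0"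
      by (simp add: c(1) inner_sum_right)
    have "c \<alpha> = 0" if "\<alpha> \<in> \<Delta>" for \<alpha>
    proof -
      have "c \<alpha> * (rho \<bullet> \<alpha>) = 0"
        using c(2)
      proof
        assume "\<forall>\<alpha>\<in>\<Delta>. 0 \<le> c \<alpha>"
        then show ?thesis
          using 0 sum_nonneg_eq_0_iff[OF finite_simple, of "\<lambda>\<alpha>. c \<alpha> * (rho \<bullet> \<alpha>)"] that
            rho_simple less_imp_le by (metis (no_types, lifting) mult_nonneg_nonneg)
      next
        assume a: "\<forall>\<alpha>\<in>\<Delta>. c \<alpha> \<le> 0"
        have "(\<Sum>\<alpha>\<in>\<Delta>. - (c \<alpha> * (rho \<bullet> \<alpha>))) = 0"
          using 0 by (simp add: sum_negf)
        moreover have "\<forall>\<alpha>\<in>\<Delta>. 0 \<le> - (c \<alpha> * (rho \<bullet> \<alpha>))"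
          using a rho_simple by (simp add: mult_nonpos_nonneg less_imp_le)
        ultimately have "- (c \<alpha> * (rho \<bullet> \<alpha>)) = 0"
          using sum_nonneg_eq_0_iff[OF finite_simple] that by (metis (no_types, lifting))
        then show ?thesis by simp
      qed
      then show ?thesis using rho_simple[OF that] by simp
    qed
    then show False using c(1) root_nonzero[OF assms] by simp
  qed
  then show ?thesis
    using assms root_minus by (auto simp: pos_def)
qed

lemma pos_minus: "\<beta> \<in> \<Phi> \<Longrightarrow> pos (- \<beta>) \<longleftrightarrow> \<not> pos \<beta>"
  using root_pos_or_neg[of \<beta>] by (auto simp: pos_def)

lemma dominant_inner_pos:
  assumes "dominant \<mu>" "\<beta> \<in> \<Phi>" "0 < \<mu> \<bullet> \<beta>"
  shows "pos \<beta>"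
  using assms dominant_pos[of \<mu> "-\<beta>"] root_pos_or_neg[of \<beta>] by auto

text \<open>Reducedness gives a simple root \<gamma> other than \<alpha> with positive coefficient
  in \<beta>. The reflection changes only the coefficient of \<alpha>, so the one of \<gamma>, read
  off by its fundamental weight, stays positive and decides the sign of the root.\<close>

lemma simple_reflection_pos:
  assumes "\<alpha> \<in> \<Delta>" "pos \<beta>" "\<beta> \<noteq> \<alpha>"
  shows "pos (reflection \<alpha> \<beta>)"
proof -
  obtain c where c: "\<beta> = (\<Sum>\<gamma>\<in>\<Delta>. c \<gamma> *\<^sub>R \<gamma>)" "\<And>\<gamma>. \<gamma> \<in> \<Delta> \<Longrightarrow> 0 \<le> c \<gamma>"
    using pos_expansion assms(2) by metis
  have "\<exists>\<gamma>\<in>\<Delta>. \<gamma> \<noteq> \<alpha> \<and> c \<gamma> \<noteq> 0"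
  proof (rule ccontr)
    assume *: "\<not> ?thesis"
    have "\<beta> = (\<Sum>\<gamma>\<in>\<Delta>. if \<gamma> = \<alpha> then c \<alpha> *\<^sub>R \<alpha> else 0)"
      by (subst c(1), rule sum.cong) (use * in auto)
    then have \<beta>: "\<beta> = c \<alpha> *\<^sub>R \<alpha>"
      using assms(1) finite_simple by simp
    then have "c \<alpha> = 1 \<or> c \<alpha> = - 1"
      using assms(1,2) simple_subset root_system unfolding root_system_def pos_def by blast
    with \<beta> assms c(2)[OF assms(1)] show False by auto
  qed
  then obtain \<gamma> where \<gamma>: "\<gamma> \<in> \<Delta>" "\<gamma> \<noteq> \<alpha>" "c \<gamma> \<noteq> 0" by blast
  have "fundamental_weight \<Delta> \<gamma> \<bullet> \<beta> = (\<Sum>\<delta>\<in>\<Delta>. if \<delta> = \<gamma> then c \<gamma> * (\<gamma> \<bullet> \<gamma>) / 2 else 0)"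
    unfolding c(1) inner_sum_right
    by (rule sum.cong) (auto simp: fundamental_weight_inner)
  also have "\<dots> > 0"
    using \<gamma> c(2)[of \<gamma>] finite_simple root_inner_pos simple_subset by auto
  finally have "0 < fundamental_weight \<Delta> \<gamma> \<bullet> reflection \<alpha> \<beta>"
    using \<gamma> assms(1) by (simp add: inner_reflection fundamental_weight_inner)
  moreover have "dominant (fundamental_weight \<Delta> \<gamma>)"
    by (simp add: dominant_def fundamental_weight_inner)
  moreover have "reflection \<alpha> \<beta> \<in> \<Phi>"
    using reflection_roots assms simple_subset pos_root by blast
  ultimately show ?thesis
    using dominant_inner_pos by blast
qed

section \<open>The Weyl group as a Coxeter group: words, exchange and length\<close>

lemma weyl_orthogonal: "w \<in> W \<Longrightarrow> orthogonal_transformation w"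
  by (simp add: weyl_group_def reflection_group_orthogonal)

lemma weyl_inner: "w \<in> W \<Longrightarrow> w x \<bullet> w y = x \<bullet> y"
  using weyl_orthogonal by (simp add: orthogonal_transformation_def)

lemma weyl_linear: "w \<in> W \<Longrightarrow> linear w"
  using weyl_orthogonal by (simp add: orthogonal_transformation_def)

lemma weyl_minus: "w \<in> W \<Longrightarrow> w (- x) = - w x"
  by (simp add: weyl_linear linear_neg)

lemma weyl_id: "id \<in> W"
  by (simp add: weyl_group_def reflection_group.one)

lemma weyl_comp: "v \<in> W \<Longrightarrow> w \<in> W \<Longrightarrow> v \<circ> w \<in> W"
  by (simp add: weyl_group_def reflection_group_comp)

lemma weyl_reflection: "\<beta> \<in> \<Phi> \<Longrightarrow> reflection \<beta> \<in> W"
  by (simp add: weyl_group_def reflection_group_reflection)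

lemma weyl_simple: "\<alpha> \<in> \<Delta> \<Longrightarrow> reflection \<alpha> \<in> W"
  using weyl_reflection simple_subset by blast

lemma weyl_roots:
  assumes "w \<in> W"
  shows "w ` \<Phi> = \<Phi>"
  using assms unfolding weyl_group_def
proof induction
  case (step \<beta> w)
  then show ?case by (simp only: image_comp[symmetric] reflection_roots)
qed simp

lemma weyl_root: "w \<in> W \<Longrightarrow> \<beta> \<in> \<Phi> \<Longrightarrow> w \<beta> \<in> \<Phi>"
  using weyl_roots by blast

lemma weyl_root_surj:
  assumes "w \<in> W" "\<beta> \<in> \<Phi>"
  obtains \<gamma> where "\<gamma> \<in> \<Phi>" "w \<gamma> = \<beta>"
proof -
  have "\<beta> \<in> w ` \<Phi>" using weyl_roots assms by simp
  then show ?thesis by (auto intro: that)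
qed

text \<open>A positive root that is not simple has positive inner product with some simple \<alpha>,
  because its norm is positive; reflecting in \<alpha> lowers its \<open>rho\<close>-value. These
  values are real, so the induction counts the roots lying below.\<close>

lemma reflection_pos_word:
  assumes "pos \<beta>"
  shows "\<exists>\<alpha>s. set \<alpha>s \<subseteq> \<Delta> \<and> reflection \<beta> = word_product \<alpha>s"
  using assms
proof (induction "card {\<gamma>\<in>\<Phi>. rho \<bullet> \<gamma> < rho \<bullet> \<beta>}" arbitrary: \<beta> rule: less_induct)
  case less
  show ?case
  proof (cases "\<beta> \<in> \<Delta>")
    case True
    then show ?thesis by (intro exI[of _ "[\<beta>]"]) simp
  next
    case False
    obtain c where c: "\<beta> = (\<Sum>\<alpha>\<in>\<Delta>. c \<alpha> *\<^sub>R \<alpha>)" "\<And>\<alpha>. \<alpha> \<in> \<Delta> \<Longrightarrow> 0 \<le> c \<alpha>"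
      using pos_expansion less.prems by metis
    have "\<exists>\<alpha>\<in>\<Delta>. 0 < \<beta> \<bullet> \<alpha>"
    proof (rule ccontr)
      assume "\<not> ?thesis"
      then have "\<beta> \<bullet> (\<Sum>\<alpha>\<in>\<Delta>. c \<alpha> *\<^sub>R \<alpha>) \<le> 0"
        unfolding inner_sum_right
        by (auto intro!: sum_nonpos mult_nonneg_nonpos c(2) simp: not_less)
      then show False
        using root_inner_pos[OF pos_root[OF less.prems]] by (simp add: c(1)[symmetric])
    qed
    then obtain \<alpha> where \<alpha>: "\<alpha> \<in> \<Delta>" "0 < \<beta> \<bullet> \<alpha>" by blast
    define \<gamma> where "\<gamma> = reflection \<alpha> \<beta>"
    have \<gamma>: "pos \<gamma>"
      using simple_reflection_pos[OF \<alpha>(1) less.prems] False \<alpha>(1) by (auto simp: \<gamma>_def)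
    have "0 < root_pairing \<beta> \<alpha>"
      using \<alpha> root_inner_pos simple_subset by (auto simp: root_pairing_def)
    then have lt: "rho \<bullet> \<gamma> < rho \<bullet> \<beta>"
      using rho_simple[OF \<alpha>(1)] by (simp add: \<gamma>_def inner_reflection)
    have "{\<delta>\<in>\<Phi>. rho \<bullet> \<delta> < rho \<bullet> \<gamma>} \<subset> {\<delta>\<in>\<Phi>. rho \<bullet> \<delta> < rho \<bullet> \<beta>}"
    proof
      show "{\<delta>\<in>\<Phi>. rho \<bullet> \<delta> < rho \<bullet> \<gamma>} \<subseteq> {\<delta>\<in>\<Phi>. rho \<bullet> \<delta> < rho \<bullet> \<beta>}" using lt by auto
      show "{\<delta>\<in>\<Phi>. rho \<bullet> \<delta> < rho \<bullet> \<gamma>} \<noteq> {\<delta>\<in>\<Phi>. rho \<bullet> \<delta> < rho \<bullet> \<beta>}" using lt pos_root[OF \<gamma>] by blast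
    qed
    then have "card {\<delta>\<in>\<Phi>. rho \<bullet> \<delta> < rho \<bullet> \<gamma>} < card {\<delta>\<in>\<Phi>. rho \<bullet> \<delta> < rho \<bullet> \<beta>}"
      using finite_roots by (intro psubset_card_mono) auto
    then obtain \<alpha>s where \<alpha>s: "set \<alpha>s \<subseteq> \<Delta>" "reflection \<gamma> = word_product \<alpha>s"
      using less.hyps \<gamma> by blast
    have "reflection \<alpha> \<circ> reflection \<beta> = reflection \<gamma> \<circ> reflection \<alpha>"
      unfolding \<gamma>_def by (rule reflection_conj[OF orthogonal_transformation_reflection])
    then have "reflection \<beta> = word_product (\<alpha> # \<alpha>s @ [\<alpha>])"
      using \<alpha>s(2) by simp (metis reflection_comp_reflection(2))
    with \<alpha>s(1) \<alpha>(1) show ?thesis by (intro exI[of _ "\<alpha> # \<alpha>s @ [\<alpha>]"]) simp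
  qed
qed

lemma weyl_group_simple: "W = reflection_group \<Delta>"
proof
  show "reflection_group \<Delta> \<subseteq> W"
    unfolding weyl_group_def by (rule reflection_group_mono[OF simple_subset])
  show "W \<subseteq> reflection_group \<Delta>"
  proof
    fix w assume "w \<in> W"
    then show "w \<in> reflection_group \<Delta>"
      unfolding weyl_group_def
    proof induction
      case (step \<beta> w)
      have "reflection \<beta> \<in> reflection_group \<Delta>"
        using root_pos_or_neg[OF step(1)] reflection_pos_word reflection_minus[of \<beta>]
        unfolding reflection_group_eq_words image_iff by (metis mem_Collect_eq)
      then show ?case using step(3) reflection_group_comp by blast
    qed (rule reflection_group.one)
  qed
qed

lemma word_in_weyl: "set \<alpha>s \<subseteq> \<Delta> \<Longrightarrow> word_product \<alpha>s \<in> W"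
  by (auto simp: weyl_group_simple reflection_group_eq_words)

lemma reduced_word:
  assumes "w \<in> W"
  obtains \<alpha>s where "set \<alpha>s \<subseteq> \<Delta>" "length \<alpha>s = len w" "word_product \<alpha>s = w"
proof -
  have "\<exists>n \<alpha>s. set \<alpha>s \<subseteq> \<Delta> \<and> length \<alpha>s = n \<and> word_product \<alpha>s = w"
    using assms by (auto simp: weyl_group_simple reflection_group_eq_words)
  from LeastI_ex[OF this] that show ?thesis
    unfolding weyl_length_def by blast
qed

lemma len_word_le: "set \<alpha>s \<subseteq> \<Delta> \<Longrightarrow> len (word_product \<alpha>s) \<le> length \<alpha>s"
  unfolding weyl_length_def by (rule Least_le) blast

text \<open>Apply the letters to \<beta> from the right: a letter \<alpha> that turns a positive
  root negative must meet \<alpha> itself, and multiplying by \<open>reflection \<beta>\<close>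
  cancels precisely that letter.\<close>

lemma exchange:
  assumes "set \<alpha>s \<subseteq> \<Delta>" "pos \<beta>" "\<not> pos (word_product \<alpha>s \<beta>)"
  shows "\<exists>\<gamma>s. set \<gamma>s \<subseteq> \<Delta> \<and> Suc (length \<gamma>s) = length \<alpha>s \<and>
    word_product \<alpha>s \<circ> reflection \<beta> = word_product \<gamma>s"
  using assms
proof (induction \<alpha>s)
  case (Cons \<alpha> \<alpha>s)
  let ?w = "word_product \<alpha>s"
  show ?case
  proof (cases "pos (?w \<beta>)")
    case True
    then have "?w \<beta> = \<alpha>"
      using Cons.prems simple_reflection_pos[of \<alpha> "?w \<beta>"] by auto
    then have "?w \<circ> reflection \<beta> = reflection \<alpha> \<circ> ?w"
      using reflection_conj[OF orthogonal_transformation_word_product] by metis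
    then have "word_product (\<alpha> # \<alpha>s) \<circ> reflection \<beta> = ?w"
      by (simp add: o_assoc[symmetric])
    moreover have "set \<alpha>s \<subseteq> \<Delta>" using Cons.prems(1) by simp
    ultimately show ?thesis by (metis length_Cons)
  next
    case False
    then obtain \<gamma>s where \<gamma>s: "set \<gamma>s \<subseteq> \<Delta>" "Suc (length \<gamma>s) = length \<alpha>s"
      "?w \<circ> reflection \<beta> = word_product \<gamma>s"
      using Cons.IH Cons.prems(1,2) by (metis set_subset_Cons subset_trans)
    then have "word_product (\<alpha> # \<alpha>s) \<circ> reflection \<beta> = word_product (\<alpha> # \<gamma>s)"
      by (simp add: o_assoc[symmetric])
    moreover have "set (\<alpha> # \<gamma>s) \<subseteq> \<Delta>" using Cons.prems(1) \<gamma>s(1) by simp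
    moreover have "Suc (length (\<alpha> # \<gamma>s)) = length (\<alpha> # \<alpha>s)" using \<gamma>s(2) by simp
    ultimately show ?thesis by blast
  qed
qed simp

lemma len_right_reflection_less:
  assumes "w \<in> W" "pos \<beta>" "\<not> pos (w \<beta>)"
  shows "len (w \<circ> reflection \<beta>) < len w"
proof -
  obtain \<alpha>s where \<alpha>s: "set \<alpha>s \<subseteq> \<Delta>" "length \<alpha>s = len w" "word_product \<alpha>s = w"
    using reduced_word assms(1) by blast
  then obtain \<gamma>s where "set \<gamma>s \<subseteq> \<Delta>" "Suc (length \<gamma>s) = length \<alpha>s"
    "w \<circ> reflection \<beta> = word_product \<gamma>s"
    using exchange[of \<alpha>s \<beta>] assms by auto
  with \<alpha>s show ?thesis using len_word_le[of \<gamma>s] by simp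
qed

text \<open>The missing direction is the same bound applied to
  \<open>w \<circ> reflection \<beta>\<close>, which sends \<beta> to
  \<open>- w \<beta>\<close>.\<close>

lemma len_right_reflection:
  assumes "w \<in> W" "pos \<beta>"
  shows "len w < len (w \<circ> reflection \<beta>) \<longleftrightarrow> pos (w \<beta>)"
    and "len (w \<circ> reflection \<beta>) < len w \<longleftrightarrow> \<not> pos (w \<beta>)"
proof -
  let ?v = "w \<circ> reflection \<beta>"
  have v: "?v \<in> W"
    using assms weyl_comp weyl_reflection pos_root by blast
  have "?v \<beta> = - w \<beta>"
    using assms by (simp add: reflection_self weyl_minus)
  then have "pos (?v \<beta>) \<longleftrightarrow> \<not> pos (w \<beta>)"
    using pos_minus[of "w \<beta>"] weyl_root assms pos_root by simp
  moreover have "?v \<circ> reflection \<beta> = w" by simp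
  ultimately have "pos (w \<beta>) \<Longrightarrow> len w < len ?v"
    using len_right_reflection_less[OF v assms(2)] by metis
  with len_right_reflection_less[OF assms]
  show "len w < len ?v \<longleftrightarrow> pos (w \<beta>)" "len ?v < len w \<longleftrightarrow> \<not> pos (w \<beta>)"
    by (blast dest: less_asym)+
qed

lemma left_eq_right_reflection:
  assumes "w \<in> W" "\<beta> \<in> \<Phi>"
  obtains \<gamma> where "pos \<gamma>" "w \<gamma> = \<beta> \<or> w \<gamma> = - \<beta>" "reflection \<beta> \<circ> w = w \<circ> reflection \<gamma>"
proof -
  obtain \<gamma> where \<gamma>: "\<gamma> \<in> \<Phi>" "w \<gamma> = \<beta>"
    using weyl_root_surj assms by metis
  then have "reflection \<beta> \<circ> w = w \<circ> reflection \<gamma>" 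
    using reflection_conj[OF weyl_orthogonal[OF assms(1)]] by metis
  then show ?thesis
    using that[of \<gamma>] that[of "-\<gamma>"] \<gamma> root_pos_or_neg[of \<gamma>] 
    by (auto simp: reflection_minus weyl_minus[OF assms(1)])
qed

text \<open>Moving the reflection to the right of \<open>w\<close> replaces \<beta> by a positive
  root \<gamma> with \<open>w \<gamma>\<close> equal to \<beta> up to sign, and dominant weights are
  nonnegative on \<gamma>. The last two parts are the source of the independence of \<mu>.\<close>

lemma len_left_reflection:
  assumes "w \<in> W" "pos \<beta>"
  shows "len w < len (reflection \<beta> \<circ> w) \<longleftrightarrow> 0 < w rho \<bullet> \<beta>"
    and "len (reflection \<beta> \<circ> w) < len w \<longleftrightarrow> w rho \<bullet> \<beta> < 0"
    and "dominant \<mu> \<Longrightarrow> len w < len (reflection \<beta> \<circ> w) \<Longrightarrow> 0 \<le> w \<mu> \<bullet> \<beta>"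
    and "dominant \<mu> \<Longrightarrow> len (reflection \<beta> \<circ> w) < len w \<Longrightarrow> w \<mu> \<bullet> \<beta> \<le> 0"
proof -
  obtain \<gamma> where \<gamma>: "pos \<gamma>" "w \<gamma> = \<beta> \<or> w \<gamma> = - \<beta>" "reflection \<beta> \<circ> w = w \<circ> reflection \<gamma>"
    using left_eq_right_reflection assms pos_root by metis
  have len: "len w < len (reflection \<beta> \<circ> w) \<longleftrightarrow> pos (w \<gamma>)"
    "len (reflection \<beta> \<circ> w) < len w \<longleftrightarrow> \<not> pos (w \<gamma>)"
    unfolding \<gamma>(3) using len_right_reflection[OF assms(1) \<gamma>(1)] by blast+
  have "0 < rho \<bullet> \<gamma>" using \<gamma>(1) by (simp add: pos_def)
  then have r: "0 < w rho \<bullet> w \<gamma>"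
    by (simp only: weyl_inner[OF assms(1)])
  have d: "dominant \<mu> \<Longrightarrow> 0 \<le> w \<mu> \<bullet> w \<gamma>"
    by (simp only: weyl_inner[OF assms(1)] dominant_pos[OF _ \<gamma>(1)])
  show "len w < len (reflection \<beta> \<circ> w) \<longleftrightarrow> 0 < w rho \<bullet> \<beta>"
    "len (reflection \<beta> \<circ> w) < len w \<longleftrightarrow> w rho \<bullet> \<beta> < 0"
    "dominant \<mu> \<Longrightarrow> len w < len (reflection \<beta> \<circ> w) \<Longrightarrow> 0 \<le> w \<mu> \<bullet> \<beta>"
    "dominant \<mu> \<Longrightarrow> len (reflection \<beta> \<circ> w) < len w \<Longrightarrow> w \<mu> \<bullet> \<beta> \<le> 0"
    unfolding len using \<gamma>(2) r d assms(2) pos_minus[OF pos_root[OF assms(2)]] by auto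
qed

lemma len_right_cases:
  assumes "w \<in> W" "\<beta> \<in> \<Phi>"
  shows "len w < len (w \<circ> reflection \<beta>) \<or> len (w \<circ> reflection \<beta>) < len w"
  using root_pos_or_neg[OF assms(2)] len_right_reflection[OF assms(1)]
  by (metis reflection_minus)

lemma len_left_cases:
  assumes "w \<in> W" "\<beta> \<in> \<Phi>"
  shows "len w < len (reflection \<beta> \<circ> w) \<or> len (reflection \<beta> \<circ> w) < len w"
proof -
  obtain \<gamma> where "pos \<gamma>" "reflection \<beta> \<circ> w = w \<circ> reflection \<gamma>"
    using left_eq_right_reflection[OF assms] by blast
  then show ?thesis using len_right_cases[OF assms(1)] pos_root by simp
qed

lemma len_simple_left_le:
  assumes "w \<in> W" "\<alpha> \<in> \<Delta>"
  shows "len (reflection \<alpha> \<circ> w) \<le> Suc (len w)"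
proof -
  obtain \<alpha>s where "set \<alpha>s \<subseteq> \<Delta>" "length \<alpha>s = len w" "word_product \<alpha>s = w"
    using reduced_word assms(1) by blast
  then show ?thesis using len_word_le[of "\<alpha> # \<alpha>s"] assms(2) by simp
qed

lemma len_simple_right_le:
  assumes "w \<in> W" "\<alpha> \<in> \<Delta>"
  shows "len (w \<circ> reflection \<alpha>) \<le> Suc (len w)"
proof -
  obtain \<alpha>s where "set \<alpha>s \<subseteq> \<Delta>" "length \<alpha>s = len w" "word_product \<alpha>s = w"
    using reduced_word assms(1) by blast
  then show ?thesis using len_word_le[of "\<alpha>s @ [\<alpha>]"] assms(2) by simp
qed

text \<open>Equal lengths are ruled out by the root criterion for reflections, in place of a parity
  argument.\<close>

lemma len_simple_left:
  assumes "w \<in> W" "\<alpha> \<in> \<Delta>"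
  shows "len (reflection \<alpha> \<circ> w) = Suc (len w) \<or> len w = Suc (len (reflection \<alpha> \<circ> w))"
proof -
  have "reflection \<alpha> \<circ> w \<in> W" using assms weyl_comp weyl_simple by blast
  from len_simple_left_le[OF this assms(2)] len_simple_left_le[OF assms]
    len_left_cases[of w \<alpha>] assms simple_subset
  show ?thesis by force
qed

lemma len_simple_right:
  assumes "w \<in> W" "\<alpha> \<in> \<Delta>"
  shows "len (w \<circ> reflection \<alpha>) = Suc (len w) \<or> len w = Suc (len (w \<circ> reflection \<alpha>))"
proof -
  have "w \<circ> reflection \<alpha> \<in> W" using assms weyl_comp weyl_simple by blast
  from len_simple_right_le[OF this assms(2)] len_simple_right_le[OF assms]
    len_right_cases[of w \<alpha>] assms simple_subset
  show ?thesis by force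
qed

lemma len_id [simp]: "len id = 0"
  using len_word_le[of "[]"] by simp

lemma len_eq_0: "w \<in> W \<Longrightarrow> len w = 0 \<Longrightarrow> w = id"
  by (erule reduced_word) auto

lemma left_descent:
  assumes "w \<in> W" "len w \<noteq> 0"
  obtains \<alpha> where "\<alpha> \<in> \<Delta>" "len (reflection \<alpha> \<circ> w) < len w"
proof -
  obtain \<alpha>s where \<alpha>s: "set \<alpha>s \<subseteq> \<Delta>" "length \<alpha>s = len w" "word_product \<alpha>s = w"
    using reduced_word assms(1) by blast
  then obtain \<alpha> \<gamma>s where \<gamma>s: "\<alpha>s = \<alpha> # \<gamma>s" using assms(2) by (cases \<alpha>s) auto
  then have "reflection \<alpha> \<circ> w = word_product \<gamma>s" using \<alpha>s(3) by auto
  then show ?thesis using that[of \<alpha>] \<alpha>s \<gamma>s len_word_le[of \<gamma>s] by auto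
qed

lemma right_descent:
  assumes "w \<in> W" "len w \<noteq> 0"
  obtains \<alpha> where "\<alpha> \<in> \<Delta>" "len (w \<circ> reflection \<alpha>) < len w"
proof -
  obtain \<alpha>s where \<alpha>s: "set \<alpha>s \<subseteq> \<Delta>" "length \<alpha>s = len w" "word_product \<alpha>s = w"
    using reduced_word assms(1) by blast
  then obtain \<alpha> \<gamma>s where \<gamma>s: "\<alpha>s = \<gamma>s @ [\<alpha>]" using assms(2) by (cases \<alpha>s rule: rev_cases) auto
  then have "w \<circ> reflection \<alpha> = word_product \<gamma>s" using \<alpha>s(3) by auto
  then show ?thesis using that[of \<alpha>] \<alpha>s \<gamma>s len_word_le[of \<gamma>s] by auto
qed

lemma weyl_inverse:
  assumes "w \<in> W"
  obtains v where "v \<in> W" "v \<circ> w = id" "w \<circ> v = id"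
proof -
  have "\<exists>v\<in>W. v \<circ> w = id \<and> w \<circ> v = id"
    using assms unfolding weyl_group_def
  proof induction
    case one
    show ?case by (intro bexI[of _ id]) (simp_all add: reflection_group.one)
  next
    case (step \<beta> w)
    then obtain v where v: "v \<in> reflection_group \<Phi>" "v \<circ> w = id" "w \<circ> v = id" by blast
    have "v \<circ> reflection \<beta> \<circ> (reflection \<beta> \<circ> w) = id"
      "reflection \<beta> \<circ> w \<circ> (v \<circ> reflection \<beta>) = id"
      using v(2,3) by (auto simp: fun_eq_iff)
    moreover have "v \<circ> reflection \<beta> \<in> reflection_group \<Phi>"
      using v(1) step(1) reflection_group_comp reflection_group_reflection by blast
    ultimately show ?case by blast
  qed
  with that show ?thesis by blast
qed

lemma weyl_eq_id:
  assumes "w \<in> W" "\<And>\<alpha>. \<alpha> \<in> \<Delta> \<Longrightarrow> pos (w \<alpha>)"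
  shows "w = id"
proof (rule len_eq_0[OF assms(1)], rule ccontr)
  assume "len w \<noteq> 0"
  then obtain \<alpha> where "\<alpha> \<in> \<Delta>" "len (w \<circ> reflection \<alpha>) < len w"
    using right_descent assms(1) by blast
  then show False
    using len_right_reflection(2)[OF assms(1) pos_simple] assms(2) by blast
qed

text \<open>The roots need not span the space, so an element is recovered from its action on \<Phi>
  through lengths: a quotient fixing all simple roots has no right descent and is
  \<open>id\<close>.\<close>

lemma finite_weyl: "finite W"
proof -
  have "inj_on (\<lambda>w. restrict w \<Phi>) W"
  proof
    fix v w assume vw: "v \<in> W" "w \<in> W" "restrict v \<Phi> = restrict w \<Phi>"
    obtain v' where v': "v' \<in> W" "v' \<circ> v = id" "v \<circ> v' = id"
      using weyl_inverse vw(1) by blast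
    have "v' \<circ> w = id"
    proof (rule weyl_eq_id)
      show "v' \<circ> w \<in> W" using weyl_comp v'(1) vw(2) by blast
      fix \<alpha> assume \<alpha>: "\<alpha> \<in> \<Delta>"
      then have "w \<alpha> = v \<alpha>" using vw(3) simple_subset by (metis restrict_apply' subsetD)
      then have "v' (w \<alpha>) = \<alpha>" using v'(2) by (metis comp_apply id_apply)
      then show "pos ((v' \<circ> w) \<alpha>)" using pos_simple[OF \<alpha>] by simp
    qed
    then show "v = w" using v'(3) by (metis comp_assoc comp_id id_comp)
  qed
  moreover have "(\<lambda>w. restrict w \<Phi>) ` W \<subseteq> \<Phi> \<rightarrow>\<^sub>E \<Phi>"
    using weyl_root by auto
  moreover have "finite (\<Phi> \<rightarrow>\<^sub>E \<Phi>)"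
    using finite_roots by (simp add: finite_PiE)
  ultimately show ?thesis
    using finite_imageD finite_subset by blast
qed

subsection \<open>The Bruhat order\<close>

abbreviation "le \<equiv> bruhat_le \<Phi> \<Delta>"

lemma le_weyl: "le u v \<Longrightarrow> u \<in> W" "le u v \<Longrightarrow> v \<in> W"
  by (simp_all add: bruhat_le_def)

lemma le_refl: "w \<in> W \<Longrightarrow> le w w"
  by (simp add: bruhat_le_def)

lemma le_trans: "le u v \<Longrightarrow> le v w \<Longrightarrow> le u w"
  by (auto simp: bruhat_le_def)

lemma bruhat_step_weyl: "bruhat_step \<Phi> \<Delta> u v \<Longrightarrow> u \<in> W \<and> v \<in> W"
  by (auto simp: bruhat_step_def intro: weyl_comp weyl_reflection)

lemma step_le: "bruhat_step \<Phi> \<Delta> u v \<Longrightarrow> le u v"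
  using bruhat_step_weyl by (auto simp: bruhat_le_def)

lemma le_len: "le u v \<Longrightarrow> len u \<le> len v"
proof -
  assume "le u v"
  then have "(bruhat_step \<Phi> \<Delta>)\<^sup>*\<^sup>* u v" by (simp add: bruhat_le_def)
  then show ?thesis by induction (auto simp: bruhat_step_def)
qed

lemma le_len_eq:
  assumes "le u v" "len v \<le> len u"
  shows "u = v"
proof -
  have "(bruhat_step \<Phi> \<Delta>)\<^sup>*\<^sup>* u v" using assms(1) by (simp add: bruhat_le_def)
  then show ?thesis
  proof (cases rule: rtranclp.cases)
    case (rtrancl_into_rtrancl w)
    then have "bruhat_step \<Phi> \<Delta> w v" "le u w"
      using assms(1) bruhat_step_weyl by (auto simp: bruhat_le_def)
    then show ?thesis using le_len[of u w] assms(2) by (auto simp: bruhat_step_def)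
  qed simp
qed

lemma le_antisym: "le u v \<Longrightarrow> le v u \<Longrightarrow> u = v"
  using le_len_eq le_len by blast

lemma right_reflection_step:
  assumes "w \<in> W" "\<beta> \<in> \<Phi>" "len w < len (w \<circ> reflection \<beta>)"
  shows "bruhat_step \<Phi> \<Delta> w (w \<circ> reflection \<beta>)"
  using assms by (auto simp: bruhat_step_def)

lemma left_reflection_step:
  assumes "w \<in> W" "\<beta> \<in> \<Phi>" "len w < len (reflection \<beta> \<circ> w)"
  shows "bruhat_step \<Phi> \<Delta> w (reflection \<beta> \<circ> w)"
proof -
  obtain \<gamma> where "pos \<gamma>" "reflection \<beta> \<circ> w = w \<circ> reflection \<gamma>"
    using left_eq_right_reflection[OF assms(1,2)] by blast
  then show ?thesis using assms pos_root right_reflection_step by metis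
qed

lemma right_reflection_le:
  "w \<in> W \<Longrightarrow> \<beta> \<in> \<Phi> \<Longrightarrow> len w < len (w \<circ> reflection \<beta>) \<Longrightarrow> le w (w \<circ> reflection \<beta>)"
  using right_reflection_step step_le by blast

lemma left_reflection_le:
  "w \<in> W \<Longrightarrow> \<beta> \<in> \<Phi> \<Longrightarrow> len w < len (reflection \<beta> \<circ> w) \<Longrightarrow> le w (reflection \<beta> \<circ> w)"
  using left_reflection_step step_le by blast

lemma right_reflection_ge:
  assumes "w \<in> W" "\<beta> \<in> \<Phi>" "len (w \<circ> reflection \<beta>) < len w"
  shows "le (w \<circ> reflection \<beta>) w"
proof -
  have "w \<circ> reflection \<beta> \<in> W" using assms weyl_comp weyl_reflection by blast
  from right_reflection_le[OF this assms(2)] assms(3) show ?thesis by simp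
qed

lemma left_reflection_ge:
  assumes "w \<in> W" "\<beta> \<in> \<Phi>" "len (reflection \<beta> \<circ> w) < len w"
  shows "le (reflection \<beta> \<circ> w) w"
proof -
  have "reflection \<beta> \<circ> w \<in> W" using assms weyl_comp weyl_reflection by blast
  from left_reflection_le[OF this assms(2)] assms(3) show ?thesis by simp
qed

lemma step_pos:
  assumes "bruhat_step \<Phi> \<Delta> u v"
  obtains \<beta> where "pos \<beta>" "v = u \<circ> reflection \<beta>" "pos (u \<beta>)"
proof -
  obtain \<beta> where \<beta>: "\<beta> \<in> \<Phi>" "v = u \<circ> reflection \<beta>" "len u < len v" "u \<in> W"
    using assms by (auto simp: bruhat_step_def)
  then show ?thesis
    using root_pos_or_neg[OF \<beta>(1)] that[of \<beta>] that[of "-\<beta>"] len_right_reflection(1)[OF \<beta>(4)]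
    by (metis reflection_minus)
qed

text \<open>For \<beta> \<noteq> \<alpha> the root of the step becomes
  \<open>reflection \<alpha> \<beta>\<close>, which is still positive, and its image under
  \<open>u \<circ> reflection \<alpha>\<close> is again the positive root
  \<open>u \<beta>\<close>.\<close>

lemma step_right_simple:
  assumes "bruhat_step \<Phi> \<Delta> u v" "\<alpha> \<in> \<Delta>"
  shows "v = u \<circ> reflection \<alpha> \<or> bruhat_step \<Phi> \<Delta> (u \<circ> reflection \<alpha>) (v \<circ> reflection \<alpha>)"
proof -
  let ?s = "reflection \<alpha>"
  obtain \<beta> where \<beta>: "pos \<beta>" "v = u \<circ> reflection \<beta>" "pos (u \<beta>)"
    using step_pos assms(1) by blast
  have W: "u \<in> W" using assms(1) bruhat_step_weyl by blast
  show ?thesis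
  proof (cases "\<beta> = \<alpha>")
    case False
    then have "pos (?s \<beta>)" using simple_reflection_pos assms(2) \<beta>(1) by blast
    moreover have "u \<circ> ?s \<in> W" using W weyl_comp weyl_simple assms(2) by blast
    moreover have "v \<circ> ?s = (u \<circ> ?s) \<circ> reflection (?s \<beta>)"
      using reflection_conj[OF orthogonal_transformation_reflection, of \<alpha> "?s \<beta>"]
        reflection_conj[OF orthogonal_transformation_reflection, of \<alpha> \<beta>] \<beta>(2)
      by (simp add: comp_assoc)
    moreover have "pos ((u \<circ> ?s) (?s \<beta>))" using \<beta>(3) by simp
    ultimately show ?thesis
      using len_right_reflection(1) right_reflection_step pos_root by metis
  qed (simp add: \<beta>(2))
qed

lemma step_left_simple:
  assumes "bruhat_step \<Phi> \<Delta> u v" "\<alpha> \<in> \<Delta>"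
  shows "v = reflection \<alpha> \<circ> u \<or> bruhat_step \<Phi> \<Delta> (reflection \<alpha> \<circ> u) (reflection \<alpha> \<circ> v)"
proof -
  let ?s = "reflection \<alpha>"
  obtain \<beta> where \<beta>: "pos \<beta>" "v = u \<circ> reflection \<beta>" "pos (u \<beta>)"
    using step_pos assms(1) by blast
  have W: "u \<in> W" using assms(1) bruhat_step_weyl by blast
  show ?thesis
  proof (cases "u \<beta> = \<alpha>")
    case False
    then have "pos ((?s \<circ> u) \<beta>)" using simple_reflection_pos assms(2) \<beta>(3) by simp
    moreover have "?s \<circ> u \<in> W" using W weyl_comp weyl_simple assms(2) by blast
    moreover have "?s \<circ> v = (?s \<circ> u) \<circ> reflection \<beta>" by (simp add: \<beta>(2) comp_assoc)
    ultimately show ?thesis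
      using len_right_reflection(1) right_reflection_step pos_root \<beta>(1) by metis
  next
    case True
    then show ?thesis using reflection_conj[OF weyl_orthogonal[OF W], of \<beta>] \<beta>(2) by simp
  qed
qed

text \<open>This treats left and right multiplication by a simple reflection uniformly.\<close>

definition lifting_involution :: "(('a \<Rightarrow> 'a) \<Rightarrow> 'a \<Rightarrow> 'a) \<Rightarrow> bool" where
  "lifting_involution \<sigma> \<longleftrightarrow>
    (\<forall>w\<in>W. \<sigma> w \<in> W \<and> \<sigma> (\<sigma> w) = w \<and> (len w < len (\<sigma> w) \<longrightarrow> le w (\<sigma> w))) \<and>
    (\<forall>u v. bruhat_step \<Phi> \<Delta> u v \<longrightarrow> v = \<sigma> u \<or> bruhat_step \<Phi> \<Delta> (\<sigma> u) (\<sigma> v))"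

lemma lifting_involution_right: "\<alpha> \<in> \<Delta> \<Longrightarrow> lifting_involution (\<lambda>w. w \<circ> reflection \<alpha>)"
  using step_right_simple right_reflection_le weyl_comp weyl_simple simple_subset
  by (auto simp: lifting_involution_def)

lemma lifting_involution_left: "\<alpha> \<in> \<Delta> \<Longrightarrow> lifting_involution (\<lambda>w. reflection \<alpha> \<circ> w)"
  using step_left_simple left_reflection_le weyl_comp weyl_simple simple_subset
  by (auto simp: lifting_involution_def)

text \<open>Induction along a chain from \<open>v\<close> down to \<open>u\<close>, with the claim
  strengthened to both \<open>u\<close> and \<open>\<sigma> u\<close>: at each step the upper
  element is the \<sigma>-image of the lower one, or \<sigma> carries the step to a step.\<close>

lemma lifting_upper:
  assumes "lifting_involution \<sigma>" "le u v" "le v m" "le (\<sigma> v) m"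
  shows "le (\<sigma> u) m"
proof -
  have \<sigma>: "\<And>w. w \<in> W \<Longrightarrow> \<sigma> w \<in> W"
    "\<And>u v. bruhat_step \<Phi> \<Delta> u v \<Longrightarrow> v = \<sigma> u \<or> bruhat_step \<Phi> \<Delta> (\<sigma> u) (\<sigma> v)"
    using assms(1) by (auto simp: lifting_involution_def)
  have "(bruhat_step \<Phi> \<Delta>)\<^sup>*\<^sup>* u v" using assms(2) by (simp add: bruhat_le_def)
  then have "le u m \<and> le (\<sigma> u) m"
  proof (induction rule: converse_rtranclp_induct)
    case base
    show ?case using assms(3,4) by simp
  next
    case (step u w)
    then show ?case using \<sigma>(2)[OF step(1)] step_le le_trans by blast
  qed
  then show ?thesis ..
qed

lemma lifting_lower:
  assumes "lifting_involution \<sigma>" "le u v" "le m u" "le m (\<sigma> u)"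
  shows "le m (\<sigma> v)"
proof -
  have \<sigma>: "\<And>w. w \<in> W \<Longrightarrow> \<sigma> w \<in> W \<and> \<sigma> (\<sigma> w) = w"
    "\<And>u v. bruhat_step \<Phi> \<Delta> u v \<Longrightarrow> v = \<sigma> u \<or> bruhat_step \<Phi> \<Delta> (\<sigma> u) (\<sigma> v)"
    using assms(1) by (auto simp: lifting_involution_def)
  have "(bruhat_step \<Phi> \<Delta>)\<^sup>*\<^sup>* u v" using assms(2) by (simp add: bruhat_le_def)
  then have "le m v \<and> le m (\<sigma> v)"
  proof (induction rule: rtranclp_induct)
    case base
    show ?case using assms(3,4) by simp
  next
    case (step w v)
    then show ?case using \<sigma>(2)[OF step(2)] \<sigma>(1) bruhat_step_weyl step_le le_trans by metis
  qed
  then show ?thesis ..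
qed

text \<open>The lifting property of Coxeter groups in four forms: the bound \<open>m\<close> is
  taken to be the longer of \<open>v\<close> and \<open>\<sigma> v\<close>, or the shorter of
  \<open>u\<close> and \<open>\<sigma> u\<close>.\<close>

lemma lifting:
  assumes "lifting_involution \<sigma>" "le u v"
  shows "len (\<sigma> v) < len v \<Longrightarrow> le (\<sigma> u) v"
    and "len v < len (\<sigma> v) \<Longrightarrow> le (\<sigma> u) (\<sigma> v)"
    and "len u < len (\<sigma> u) \<Longrightarrow> le u (\<sigma> v)"
    and "len (\<sigma> u) < len u \<Longrightarrow> le (\<sigma> u) (\<sigma> v)"
proof -
  have \<sigma>: "\<And>w. w \<in> W \<Longrightarrow> \<sigma> w \<in> W" "\<And>w. w \<in> W \<Longrightarrow> \<sigma> (\<sigma> w) = w"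
    "\<And>w. w \<in> W \<Longrightarrow> len w < len (\<sigma> w) \<Longrightarrow> le w (\<sigma> w)"
    using assms(1) by (auto simp: lifting_involution_def)
  have le: "len (\<sigma> w) < len w \<Longrightarrow> le (\<sigma> w) w" if "w \<in> W" for w
    using \<sigma>(3)[of "\<sigma> w"] \<sigma>(1,2)[OF that] by simp
  have uv: "u \<in> W" "v \<in> W" using assms(2) le_weyl by blast+
  show "len (\<sigma> v) < len v \<Longrightarrow> le (\<sigma> u) v"
    using lifting_upper[OF assms] le_refl le uv by blast
  show "len v < len (\<sigma> v) \<Longrightarrow> le (\<sigma> u) (\<sigma> v)"
    using lifting_upper[OF assms] le_refl \<sigma> uv by blast
  show "len u < len (\<sigma> u) \<Longrightarrow> le u (\<sigma> v)"
    using lifting_lower[OF assms] le_refl \<sigma> uv by blast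
  show "len (\<sigma> u) < len u \<Longrightarrow> le (\<sigma> u) (\<sigma> v)"
    using lifting_lower[OF assms] le_refl le \<sigma> uv by blast
qed

lemmas lifting_left = lifting[OF lifting_involution_left]
  and lifting_right = lifting[OF lifting_involution_right]

subsection \<open>Local maxima and the Hecke algebra\<close>

text \<open>The coefficient of \<open>q\<^sup>n y\<close> in \<open>T\<^bsub>\<alpha>\<^sub>k\<^esub> \<cdots> T\<^bsub>\<alpha>\<^sub>1\<^esub> v\<close>, where \<open>T\<^bsub>\<alpha>\<^esub>\<close> is the Hecke operator with
  \<open>T\<^bsub>\<alpha>\<^esub>\<^sup>2 = 1 + q T\<^bsub>\<alpha>\<^esub>\<close> of the left regular representation.\<close>

primrec hecke :: "'a list \<Rightarrow> ('a \<Rightarrow> 'a) \<Rightarrow> ('a \<Rightarrow> 'a) \<Rightarrow> nat \<Rightarrow> nat" where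
  "hecke [] v y n = (if v = y \<and> n = 0 then 1 else 0)"
| "hecke (\<alpha> # \<alpha>s) v y n = hecke \<alpha>s (reflection \<alpha> \<circ> v) y n +
    (if len (reflection \<alpha> \<circ> v) < len v \<and> n \<noteq> 0 then hecke \<alpha>s v y (n - 1) else 0)"

lemma hecke_Cons_pos:
  assumes "0 < hecke (\<alpha> # \<alpha>s) v y n"
  shows "0 < hecke \<alpha>s (reflection \<alpha> \<circ> v) y n \<or>
    len (reflection \<alpha> \<circ> v) < len v \<and> n \<noteq> 0 \<and> 0 < hecke \<alpha>s v y (n - 1)"
  using assms by (auto split: if_splits)

lemma comp_reflection_eq_iff: "v \<circ> reflection \<alpha> = y \<longleftrightarrow> v = y \<circ> reflection \<alpha>"
  by auto

text \<open>Left Hecke operators commute with right ones.\<close>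

lemma hecke_right:
  assumes "set \<alpha>s \<subseteq> \<Delta>" "\<alpha> \<in> \<Delta>" "v \<in> W" "p \<in> W" "len v < len (v \<circ> reflection \<alpha>)"
  shows "hecke \<alpha>s (v \<circ> reflection \<alpha>) p n = hecke \<alpha>s v (p \<circ> reflection \<alpha>) n +
    (if len (p \<circ> reflection \<alpha>) < len p \<and> n \<noteq> 0 then hecke \<alpha>s v p (n - 1) else 0)"
  using assms(1,3,4,5)
proof (induction \<alpha>s arbitrary: v p n)
  case Nil
  then show ?case by (auto simp: comp_reflection_eq_iff)
next
  case (Cons \<gamma> \<alpha>s)
  let ?s = "reflection \<alpha>" and ?r = "reflection \<gamma>"
  have \<gamma>: "\<gamma> \<in> \<Delta>" and \<alpha>s: "set \<alpha>s \<subseteq> \<Delta>" using Cons.prems(1) by simp_all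
  note v = Cons.prems(2,4) and p = Cons.prems(3)
  note IH = Cons.IH[OF \<alpha>s]
  have rv: "?r \<circ> v \<in> W" using weyl_comp weyl_simple \<gamma> v(1) by blast
  have vs: "v \<circ> ?s \<in> W" using weyl_comp weyl_simple assms(2) v(1) by blast
  have assoc: "?r \<circ> (v \<circ> ?s) = ?r \<circ> v \<circ> ?s" by (rule comp_assoc[symmetric])
  note lens = len_simple_left[OF v(1) \<gamma>] len_simple_left[OF vs \<gamma>, unfolded assoc]
    len_simple_right[OF rv assms(2)] len_simple_right[OF v(1) assms(2)] v(2)
  show ?case
  proof (cases "len v < len (?r \<circ> v)")
    case up: True
    show ?thesis
    proof (cases "len (?r \<circ> v) < len (?r \<circ> v \<circ> ?s)")
      case True
      have "\<not> len (?r \<circ> v) < len v" "\<not> len (?r \<circ> v \<circ> ?s) < len (v \<circ> ?s)"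
        using up True lens by linarith+
      then show ?thesis
        unfolding hecke.simps assoc IH[OF rv p True] by (simp del: o_apply)
    next
      case False
      have step: "bruhat_step \<Phi> \<Delta> v (?r \<circ> v)"
        using left_reflection_step v(1) up \<gamma> simple_subset by blast
      have "\<not> len (v \<circ> ?s) < len (?r \<circ> v \<circ> ?s)"
        using False lens up by linarith
      then have "\<not> bruhat_step \<Phi> \<Delta> (v \<circ> ?s) (?r \<circ> v \<circ> ?s)"
        by (simp only: bruhat_step_def simp_thms)
      \<comment> \<open>Each reflection alone lengthens \<open>v\<close>, but both together do not
        lengthen it further, so the two upward moves coincide.\<close>
      then have eq: "?r \<circ> v = v \<circ> ?s"
        using step_right_simple[OF step assms(2)] by blast
      have eq2: "?r \<circ> (v \<circ> ?s) = v" unfolding assoc eq by (rule reflection_comp_reflection(3))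
      have ps: "p \<circ> ?s \<in> W" using weyl_comp weyl_simple assms(2) p by blast
      \<comment> \<open>Of \<open>p\<close> and \<open>p \<circ> ?s\<close> exactly one has the
        simple reflection as a right descent, so the q-term appears once in either case.\<close>
      note IHs = IH[OF v(1) ps v(2), unfolded reflection_comp_reflection(3)] IH[OF v(1) p v(2)]
      have "\<not> len (v \<circ> ?s) < len v" using v(2) by linarith
      moreover have "len p < len (p \<circ> ?s) \<longleftrightarrow> \<not> len (p \<circ> ?s) < len p"
        using len_simple_right[OF p assms(2)] by linarith
      ultimately show ?thesis
        unfolding hecke.simps eq2 eq IHs using v(2) by (simp del: o_apply)
    qed
  next
    case False
    \<comment> \<open>The length of \<open>?r \<circ> v \<circ> ?s\<close> differs by 1 from both
      \<open>len v - 1\<close> and \<open>len v + 1\<close>, so it is \<open>len v\<close>.\<close>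
    have l: "len (?r \<circ> v) < len v" "len (?r \<circ> v \<circ> ?s) < len (v \<circ> ?s)"
      "len (?r \<circ> v) < len (?r \<circ> v \<circ> ?s)"
      using False lens by linarith+
    then show ?thesis
      unfolding hecke.simps assoc IH[OF rv p l(3)] IH[OF v(1) p v(2)] by (simp del: o_apply)
  qed
qed

lemma hecke_0: "hecke \<alpha>s v y 0 = (if y = word_product (rev \<alpha>s) \<circ> v then 1 else 0)"
proof (induction \<alpha>s arbitrary: v)
  case (Cons \<alpha> \<alpha>s)
  have "word_product (rev (\<alpha> # \<alpha>s)) \<circ> v = word_product (rev \<alpha>s) \<circ> (reflection \<alpha> \<circ> v)"
    by (simp add: comp_assoc)
  then show ?case using Cons[of "reflection \<alpha> \<circ> v"] by (simp del: o_apply)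
qed (simp add: eq_commute)

text \<open>Coefficients are natural numbers, so a contribution through the midpoint
  \<open>z\<close> cannot be cancelled.\<close>

lemma hecke_append_pos:
  assumes "0 < hecke \<alpha>s v z i" "0 < hecke \<beta>s z y j"
  shows "0 < hecke (\<alpha>s @ \<beta>s) v y (i + j)"
  using assms(1)
proof (induction \<alpha>s arbitrary: v i)
  case Nil
  then show ?case using assms(2) by (auto split: if_splits)
next
  case (Cons \<alpha> \<alpha>s)
  have "0 < hecke \<alpha>s (reflection \<alpha> \<circ> v) z i \<or>
    len (reflection \<alpha> \<circ> v) < len v \<and> i \<noteq> 0 \<and> 0 < hecke \<alpha>s v z (i - 1)"
    using hecke_Cons_pos[OF Cons.prems] .
  then show ?case
  proof (elim disjE conjE)
    assume "0 < hecke \<alpha>s (reflection \<alpha> \<circ> v) z i"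
    from Cons.IH[OF this] show ?thesis by (simp del: o_apply)
  next
    assume i: "len (reflection \<alpha> \<circ> v) < len v" "i \<noteq> 0" "0 < hecke \<alpha>s v z (i - 1)"
    have "i - 1 + j = i + j - 1" using i(2) by simp
    with Cons.IH[OF i(3)] i(1,2) show ?thesis by (simp del: o_apply)
  qed
qed

text \<open>At each letter the two contributions take the same branch, where the induction applies,
  or different branches, which give at least 1 each.\<close>

lemma hecke_append_pos2:
  assumes "0 < hecke \<alpha>s v z i" "0 < hecke \<beta>s z y j"
    and "0 < hecke \<alpha>s v z' i'" "0 < hecke \<beta>s z' y j'"
    and "z \<noteq> z'" "i + j = i' + j'"
  shows "2 \<le> hecke (\<alpha>s @ \<beta>s) v y (i + j)"
  using assms(1,3,6)
proof (induction \<alpha>s arbitrary: v i i')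
  case Nil
  then show ?case using assms(5) by (auto split: if_splits)
next
  case (Cons \<alpha> \<alpha>s)
  let ?v = "reflection \<alpha> \<circ> v"
  let ?A = "hecke (\<alpha>s @ \<beta>s) ?v y (i + j)" and ?B = "hecke (\<alpha>s @ \<beta>s) v y (i + j - 1)"
  have sum: "hecke ((\<alpha> # \<alpha>s) @ \<beta>s) v y (i + j) =
    ?A + (if len ?v < len v \<and> i + j \<noteq> 0 then ?B else 0)"
    by simp
  have 1: "0 < hecke \<alpha>s ?v z i \<or> len ?v < len v \<and> i \<noteq> 0 \<and> 0 < hecke \<alpha>s v z (i - 1)"
    using hecke_Cons_pos[OF Cons.prems(1)] .
  have 2: "0 < hecke \<alpha>s ?v z' i' \<or> len ?v < len v \<and> i' \<noteq> 0 \<and> 0 < hecke \<alpha>s v z' (i' - 1)"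
    using hecke_Cons_pos[OF Cons.prems(2)] .
  have a: "0 < hecke \<alpha>s ?v z i \<Longrightarrow> 0 < ?A"
    using hecke_append_pos[OF _ assms(2)] by blast
  have a': "0 < hecke \<alpha>s ?v z' i' \<Longrightarrow> 0 < ?A"
    using hecke_append_pos[OF _ assms(4)] Cons.prems(3) by metis
  have b: "i \<noteq> 0 \<Longrightarrow> 0 < hecke \<alpha>s v z (i - 1) \<Longrightarrow> 0 < ?B"
    using hecke_append_pos[OF _ assms(2), of \<alpha>s v "i - 1"] by simp
  have b': "i' \<noteq> 0 \<Longrightarrow> 0 < hecke \<alpha>s v z' (i' - 1) \<Longrightarrow> 0 < ?B"
    using hecke_append_pos[OF _ assms(4), of \<alpha>s v "i' - 1"] Cons.prems(3) by simp
  have aa: "0 < hecke \<alpha>s ?v z i \<Longrightarrow> 0 < hecke \<alpha>s ?v z' i' \<Longrightarrow> 2 \<le> ?A"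
    using Cons.IH Cons.prems(3) by blast
  have bb: "i \<noteq> 0 \<Longrightarrow> i' \<noteq> 0 \<Longrightarrow> 0 < hecke \<alpha>s v z (i - 1) \<Longrightarrow> 0 < hecke \<alpha>s v z' (i' - 1) \<Longrightarrow> 2 \<le> ?B"
    using Cons.IH[of v "i - 1" "i' - 1"] Cons.prems(3) by simp
  show ?case
    unfolding sum using 1 2
  proof (elim disjE conjE)
    assume "0 < hecke \<alpha>s ?v z i" "0 < hecke \<alpha>s ?v z' i'"
    then show "2 \<le> ?A + (if len ?v < len v \<and> i + j \<noteq> 0 then ?B else 0)" using aa by simp
  next
    assume "len ?v < len v" "i \<noteq> 0" "0 < hecke \<alpha>s v z (i - 1)"
      "i' \<noteq> 0" "0 < hecke \<alpha>s v z' (i' - 1)"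
    then show "2 \<le> ?A + (if len ?v < len v \<and> i + j \<noteq> 0 then ?B else 0)" using bb by simp
  next
    assume "0 < hecke \<alpha>s ?v z i" "len ?v < len v" "i' \<noteq> 0" "0 < hecke \<alpha>s v z' (i' - 1)"
    moreover from this have "i + j \<noteq> 0" using Cons.prems(3) by simp
    ultimately show "2 \<le> ?A + (if len ?v < len v \<and> i + j \<noteq> 0 then ?B else 0)"
      using a b' by fastforce
  next
    assume "len ?v < len v" "i \<noteq> 0" "0 < hecke \<alpha>s v z (i - 1)" "0 < hecke \<alpha>s ?v z' i'"
    then show "2 \<le> ?A + (if len ?v < len v \<and> i + j \<noteq> 0 then ?B else 0)"
      using a' b by fastforce
  qed
qed

lemma hecke_append_split:
  assumes "0 < hecke (\<alpha>s @ \<beta>s) v y n"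
  obtains z i where "i \<le> n" "0 < hecke \<alpha>s v z i" "0 < hecke \<beta>s z y (n - i)"
proof -
  have "\<exists>z i. i \<le> n \<and> 0 < hecke \<alpha>s v z i \<and> 0 < hecke \<beta>s z y (n - i)"
    using assms
  proof (induction \<alpha>s arbitrary: v n)
    case Nil
    then show ?case by (intro exI[of _ v] exI[of _ 0]) simp
  next
    case (Cons \<alpha> \<alpha>s)
    let ?v = "reflection \<alpha> \<circ> v"
    have "0 < hecke (\<alpha>s @ \<beta>s) ?v y n \<or>
      len ?v < len v \<and> n \<noteq> 0 \<and> 0 < hecke (\<alpha>s @ \<beta>s) v y (n - 1)"
      using hecke_Cons_pos[OF Cons.prems[unfolded append_Cons]] .
    then show ?case
    proof
      assume "0 < hecke (\<alpha>s @ \<beta>s) ?v y n"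
      then obtain z i where "i \<le> n" "0 < hecke \<alpha>s ?v z i" "0 < hecke \<beta>s z y (n - i)"
        using Cons.IH by blast
      then show ?thesis by (intro exI[of _ z] exI[of _ i]) simp
    next
      assume *: "len ?v < len v \<and> n \<noteq> 0 \<and> 0 < hecke (\<alpha>s @ \<beta>s) v y (n - 1)"
      then obtain z i where "i \<le> n - 1" "0 < hecke \<alpha>s v z i" "0 < hecke \<beta>s z y (n - 1 - i)"
        using Cons.IH by blast
      with * have "Suc i \<le> n" "0 < hecke (\<alpha> # \<alpha>s) v z (Suc i)" "0 < hecke \<beta>s z y (n - Suc i)"
        by (cases n; simp)+
      then show ?thesis by blast
    qed
  qed
  with that show ?thesis by blast
qed

section \<open>Descending paths in the Bruhat graph with prescribed labels\<close>

definition down_step :: "('a \<Rightarrow> bool) \<Rightarrow> ('a \<Rightarrow> 'a) \<Rightarrow> ('a \<Rightarrow> 'a) \<Rightarrow> bool" where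
  "down_step P v w \<longleftrightarrow> (\<exists>\<beta>. pos \<beta> \<and> P \<beta> \<and> w = reflection \<beta> \<circ> v \<and> len w < len v)"

lemma down_path_le:
  "(down_step P ^^ n) v p \<Longrightarrow> v \<in> W \<Longrightarrow> p \<in> W \<and> le p v \<and> n + len p \<le> len v"
proof (induction n arbitrary: p)
  case 0
  then show ?case using le_refl by simp
next
  case (Suc n)
  then obtain w where w: "(down_step P ^^ n) v w" "down_step P w p" by auto
  then have w': "w \<in> W" "le w v" "n + len w \<le> len v" using Suc by auto
  obtain \<beta> where \<beta>: "pos \<beta>" "p = reflection \<beta> \<circ> w" "len p < len w"
    using w(2) by (auto simp: down_step_def)
  then have "le p w" using left_reflection_ge[OF w'(1) pos_root[OF \<beta>(1)]] by simp
  then show ?case using le_trans w' le_weyl(1) \<beta>(3) by force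
qed

text \<open>The labels of a word \<open>\<alpha>\<^sub>1, \<dots>, \<alpha>\<^sub>k\<close>, applied to \<open>x\<close> from the left, are the roots
  \<open>x\<^sub>i\<inverse> \<alpha>\<^sub>i\<close> with \<open>x\<^sub>i = s\<^bsub>i-1\<^esub> \<cdots> s\<^sub>1 x\<close>; if they are all positive, every letter increases the
  length.\<close>

primrec labelled :: "('a \<Rightarrow> bool) \<Rightarrow> 'a list \<Rightarrow> ('a \<Rightarrow> 'a) \<Rightarrow> bool" where
  "labelled P [] x \<longleftrightarrow> True"
| "labelled P (\<alpha> # \<alpha>s) x \<longleftrightarrow>
    \<alpha> \<in> \<Delta> \<and> (\<exists>\<beta>. pos \<beta> \<and> P \<beta> \<and> x \<beta> = \<alpha>) \<and> labelled P \<alpha>s (reflection \<alpha> \<circ> x)"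

lemma labelled_simple: "labelled P \<alpha>s x \<Longrightarrow> set \<alpha>s \<subseteq> \<Delta>"
  by (induction \<alpha>s arbitrary: x) auto

lemma labelled_mono: "labelled P \<alpha>s x \<Longrightarrow> (\<And>\<beta>. P \<beta> \<Longrightarrow> Q \<beta>) \<Longrightarrow> labelled Q \<alpha>s x"
  by (induction \<alpha>s arbitrary: x) auto

lemma labelled_append:
  "labelled P (\<alpha>s @ \<beta>s) x \<longleftrightarrow> labelled P \<alpha>s x \<and> labelled P \<beta>s (word_product (rev \<alpha>s) \<circ> x)"
  by (induction \<alpha>s arbitrary: x) (simp_all add: comp_assoc)

text \<open>Conjugating the word away turns Hecke coefficients into counts of descending paths in the
  Bruhat graph.\<close>

lemma hecke_path:
  assumes "labelled P \<alpha>s x" "x \<in> W" "v \<in> W" "0 < hecke \<alpha>s (x \<circ> v) y n"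
  obtains p where "y = word_product (rev \<alpha>s) \<circ> x \<circ> p" "(down_step P ^^ n) v p"
proof -
  have "\<exists>p. y = word_product (rev \<alpha>s) \<circ> x \<circ> p \<and> (down_step P ^^ n) v p"
    using assms
  proof (induction \<alpha>s arbitrary: x v n)
    case Nil
    then show ?case by (auto split: if_splits)
  next
    case (Cons \<alpha> \<alpha>s)
    let ?s = "reflection \<alpha>"
    obtain \<beta> where \<beta>: "pos \<beta>" "P \<beta>" "x \<beta> = \<alpha>" and \<alpha>: "\<alpha> \<in> \<Delta>"
      and lab: "labelled P \<alpha>s (?s \<circ> x)"
      using Cons.prems(1) by auto
    have sx: "?s \<circ> x \<in> W" using weyl_comp weyl_simple \<alpha> Cons.prems(2) by blast
    have conj: "x \<circ> reflection \<beta> = ?s \<circ> x"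
      using reflection_conj[OF weyl_orthogonal[OF Cons.prems(2)], of \<beta>] \<beta>(3) by simp
    have "0 < hecke \<alpha>s (?s \<circ> x \<circ> v) y n \<or>
      len (?s \<circ> (x \<circ> v)) < len (x \<circ> v) \<and> n \<noteq> 0 \<and> 0 < hecke \<alpha>s (x \<circ> v) y (n - 1)"
      using hecke_Cons_pos[OF Cons.prems(4)] unfolding comp_assoc .
    then show ?case
    proof (elim disjE conjE)
      assume "0 < hecke \<alpha>s (?s \<circ> x \<circ> v) y n"
      then show ?thesis using Cons.IH[OF lab sx Cons.prems(3)]
        by (simp add: comp_assoc del: o_apply)
    next
      assume a: "len (?s \<circ> (x \<circ> v)) < len (x \<circ> v)" "n \<noteq> 0" "0 < hecke \<alpha>s (x \<circ> v) y (n - 1)"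
      let ?v = "reflection \<beta> \<circ> v"
      have v: "?v \<in> W" using weyl_comp weyl_reflection pos_root \<beta>(1) Cons.prems(3) by blast
      have xv: "x \<circ> v \<in> W" using weyl_comp Cons.prems(2,3) by blast
      \<comment> \<open>Since \<open>x \<beta>\<close> = \<alpha>, the descent condition for
        \<alpha> at \<open>x \<circ> v\<close> is the one for \<beta> at \<open>v\<close>.\<close>
      have "(x \<circ> v) rho \<bullet> \<alpha> < 0"
        using a(1) len_left_reflection(2)[OF xv pos_simple[OF \<alpha>]] by blast
      moreover have "(x \<circ> v) rho \<bullet> \<alpha> = v rho \<bullet> \<beta>"
        using weyl_inner[OF Cons.prems(2), of "v rho" \<beta>] unfolding \<beta>(3) by simp
      ultimately have "len ?v < len v"
        using len_left_reflection(2)[OF Cons.prems(3) \<beta>(1)] by simp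
      then have step: "down_step P v ?v" using \<beta> by (auto simp: down_step_def)
      \<comment> \<open>The q-branch leaves \<open>x \<circ> v\<close> unchanged; relative to the
        advanced prefix \<open>?s \<circ> x\<close> this means that \<open>v\<close> has moved down
        to \<open>?v\<close>.\<close>
      have "x \<circ> v = ?s \<circ> x \<circ> ?v"
        unfolding conj[symmetric] by (simp add: comp_assoc)
      then have "0 < hecke \<alpha>s (?s \<circ> x \<circ> ?v) y (n - 1)" using a(3) by simp
      from Cons.IH[OF lab sx v this] obtain p where
        p: "y = word_product (rev \<alpha>s) \<circ> (?s \<circ> x) \<circ> p" "(down_step P ^^ (n - 1)) ?v p"
        by blast
      have "(down_step P ^^ n) v p"
        using relpowp_Suc_I2[of "down_step P", OF step p(2)] a(2) by simp
      then show ?thesis using p(1) by (auto simp: comp_assoc simp del: o_apply)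
    qed
  qed
  with that show ?thesis by blast
qed

section \<open>The longest element and leading coefficients of R-polynomials\<close>

lemma weyl_comp_cancel:
  assumes "x \<in> W" "x \<circ> v = x \<circ> w"
  shows "v = w"
  using orthogonal_transformation_inj[OF weyl_orthogonal[OF assms(1)]] assms(2)
  by (simp add: fun_eq_iff inj_eq)

text \<open>A reduced word of the longest element, recognised by making every positive root
  negative. The product runs over \<open>rev \<alpha>s\<close> because the letters are multiplied on
  from the left in turn.\<close>

definition longest_word :: "'a list \<Rightarrow> bool" where
  "longest_word \<alpha>s \<longleftrightarrow> labelled (\<lambda>_. True) \<alpha>s id \<and> (\<forall>\<beta>. pos \<beta> \<longrightarrow> \<not> pos (word_product (rev \<alpha>s) \<beta>))"

lemma longest_word_weyl:
  assumes "longest_word \<alpha>s"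
  shows "set \<alpha>s \<subseteq> \<Delta>" "word_product (rev \<alpha>s) \<in> W"
  using assms labelled_simple word_in_weyl[of "rev \<alpha>s"] by (auto simp: longest_word_def)

text \<open>Support and degree bound of the R-polynomial: a nonzero coefficient produces a
  descending path from \<open>v\<close> to \<open>u\<close> with \<open>n\<close> steps, each of
  which lowers the length.\<close>

lemma hecke_longest_le:
  assumes "longest_word \<alpha>s" "u \<in> W" "v \<in> W"
    and "0 < hecke \<alpha>s v (word_product (rev \<alpha>s) \<circ> u) n"
  shows "le u v" "n + len u \<le> len v"
proof -
  let ?x = "word_product (rev \<alpha>s)"
  have "labelled (\<lambda>_. True) \<alpha>s id" using assms(1) by (simp add: longest_word_def)
  from hecke_path[OF this weyl_id assms(3)] assms(4)
  obtain p where p: "?x \<circ> u = ?x \<circ> p" "(down_step (\<lambda>_. True) ^^ n) v p"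
    by auto
  then have "p = u" using weyl_comp_cancel longest_word_weyl(2)[OF assms(1)] by metis
  then show "le u v" "n + len u \<le> len v" using down_path_le[OF p(2) assms(3)] by auto
qed

text \<open>These coefficients are those of the R-polynomials.\<close>

lemma hecke_longest:
  assumes "longest_word \<alpha>s" "le u v"
  shows "hecke \<alpha>s v (word_product (rev \<alpha>s) \<circ> u) (len v - len u) = 1"
  using assms(2)
proof (induction "len v" arbitrary: u v rule: less_induct)
  case less
  let ?x = "word_product (rev \<alpha>s)"
  have uv: "u \<in> W" "v \<in> W" using less.prems le_weyl by auto
  show ?case
  proof (cases "len v = 0")
    case True
    then have "u = v" using le_len_eq less.prems by simp
    then show ?thesis by (simp add: hecke_0)
  next
    case False
    then obtain \<alpha> where \<alpha>: "\<alpha> \<in> \<Delta>" "len (v \<circ> reflection \<alpha>) < len v"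
      using right_descent uv(2) by blast
    let ?s = "reflection \<alpha>"
    define w where "w = v \<circ> ?s"
    have w: "w \<in> W" "v = w \<circ> ?s" "len w < len v"
      using weyl_comp weyl_simple uv \<alpha> by (auto simp: w_def)
    have len_v: "len v = Suc (len w)"
      using len_simple_right[OF w(1) \<alpha>(1)] w(2,3) by auto
    have us: "u \<circ> ?s \<in> W" using weyl_comp weyl_simple uv \<alpha>(1) by blast
    have xu: "?x \<circ> u \<in> W" using weyl_comp longest_word_weyl(2)[OF assms(1)] uv by blast
    \<comment> \<open>Left multiplication by the longest element exchanges right ascents and
      descents.\<close>
    have down: "len (?x \<circ> u \<circ> ?s) < len (?x \<circ> u) \<longleftrightarrow> len u < len (u \<circ> ?s)"
    proof -
      have "u \<alpha> \<in> \<Phi>" using weyl_root uv \<alpha>(1) simple_subset by blast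
      then have "pos (u \<alpha>) \<longleftrightarrow> \<not> pos (?x (u \<alpha>))"
        using assms(1) root_pos_or_neg[of "u \<alpha>"] weyl_minus[OF longest_word_weyl(2)[OF assms(1)]]
          pos_minus[of "u \<alpha>"] pos_minus[of "?x (u \<alpha>)"] weyl_root[OF longest_word_weyl(2)[OF assms(1)]]
        unfolding longest_word_def by metis
      then show ?thesis
        using len_right_reflection[OF xu pos_simple[OF \<alpha>(1)]]
          len_right_reflection[OF uv(1) pos_simple[OF \<alpha>(1)]] by simp
    qed
    \<comment> \<open>The recursion of R-polynomials at a right descent s of \<open>v\<close>: (u,
      v) passes to (us, vs), plus q times (u, vs) if s is an ascent of \<open>u\<close>.\<close>
    have rec: "hecke \<alpha>s v (?x \<circ> u) n = hecke \<alpha>s w (?x \<circ> (u \<circ> ?s)) n +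
      (if len u < len (u \<circ> ?s) \<and> n \<noteq> 0 then hecke \<alpha>s w (?x \<circ> u) (n - 1) else 0)" for n
      using hecke_right[OF longest_word_weyl(1)[OF assms(1)] \<alpha>(1) w(1) xu, of n] w down
      by (simp add: comp_assoc)
    show ?thesis
    proof (cases "len u < len (u \<circ> ?s)")
      case True
      then have "le u w" using lifting_right(3)[OF \<alpha>(1) less.prems] by (simp add: w_def)
      then have "hecke \<alpha>s w (?x \<circ> u) (len w - len u) = 1" "len u \<le> len w"
        using less.hyps[OF w(3)] le_len by auto
      \<comment> \<open>The degree bound removes this term: the length difference of
        \<open>u \<circ> ?s\<close> and \<open>w\<close> is two less than that of \<open>u\<close>
        and \<open>v\<close>.\<close>
      moreover have "\<not> 0 < hecke \<alpha>s w (?x \<circ> (u \<circ> ?s)) (len v - len u)"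
        using hecke_longest_le(2)[OF assms(1) us w(1)] True len_v by fastforce
      ultimately show ?thesis
        using rec True len_v by (simp add: Suc_diff_le)
    next
      case False
      then have "len u = Suc (len (u \<circ> ?s))" using len_simple_right[OF uv(1) \<alpha>(1)] by auto
      moreover from this have "le (u \<circ> ?s) w"
        using lifting_right(4)[OF \<alpha>(1) less.prems] by (simp add: w_def)
      then have "hecke \<alpha>s w (?x \<circ> (u \<circ> ?s)) (len w - len (u \<circ> ?s)) = 1"
        using less.hyps[OF w(3)] by auto
      ultimately show ?thesis using rec False len_v by simp
    qed
  qed
qed

section \<open>Generic functionals and uniqueness of local maxima\<close>

definition generic :: "'a \<Rightarrow> bool" where
  "generic \<eta> \<longleftrightarrow> (\<forall>\<beta>\<in>\<Phi>. \<eta> \<bullet> \<beta> \<noteq> 0)"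

lemma len_bounded: "w \<in> W \<Longrightarrow> len w \<le> Max (len ` W)"
  using finite_weyl by simp

text \<open>While \<open>x \<eta>\<close> is positive on some simple root, multiply by its
  reflection. The invariant is that \<eta> is positive on all inversions of \<open>x\<close>;
  bounded length makes this stop.\<close>

lemma antidominant_word:
  assumes "generic \<eta>" "x \<in> W" "\<And>\<beta>. pos \<beta> \<Longrightarrow> \<not> pos (x \<beta>) \<Longrightarrow> 0 < \<eta> \<bullet> \<beta>"
  shows "\<exists>\<alpha>s. labelled (\<lambda>\<beta>. 0 < \<eta> \<bullet> \<beta>) \<alpha>s x \<and>
    (\<forall>\<alpha>\<in>\<Delta>. (word_product (rev \<alpha>s) \<circ> x) \<eta> \<bullet> \<alpha> < 0)"
  using assms(2,3)
proof (induction "Max (len ` W) - len x" arbitrary: x rule: less_induct)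
  case less
  show ?case
  proof (cases "\<forall>\<alpha>\<in>\<Delta>. x \<eta> \<bullet> \<alpha> < 0")
    case True
    then show ?thesis by (intro exI[of _ "[]"]) simp
  next
    case False
    then obtain \<alpha> where \<alpha>: "\<alpha> \<in> \<Delta>" "\<not> x \<eta> \<bullet> \<alpha> < 0" by blast
    obtain \<gamma> where \<gamma>: "\<gamma> \<in> \<Phi>" "x \<gamma> = \<alpha>"
      using weyl_root_surj[OF less.prems(1)] \<alpha>(1) simple_subset by (metis subsetD)
    have \<eta>\<gamma>: "0 < \<eta> \<bullet> \<gamma>"
      using \<alpha>(2) assms(1) \<gamma> weyl_inner[OF less.prems(1), of \<eta> \<gamma>] by (force simp: generic_def)
    \<comment> \<open>Otherwise \<open>- \<gamma>\<close> would be an inversion of \<open>x\<close>,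
      where \<eta> is positive by the invariant.\<close>
    have "pos \<gamma>"
    proof (rule ccontr)
      assume "\<not> pos \<gamma>"
      moreover have "x (- \<gamma>) = - \<alpha>" using \<gamma> weyl_minus[OF less.prems(1)] by simp
      ultimately have "0 < \<eta> \<bullet> (- \<gamma>)"
        using less.prems(2)[of "- \<gamma>"] pos_minus[of \<gamma>] \<gamma>(1) pos_minus[of \<alpha>] pos_simple[OF \<alpha>(1)]
          pos_root by simp
      then show False using \<eta>\<gamma> by simp
    qed
    let ?x = "reflection \<alpha> \<circ> x"
    have x: "?x \<in> W" using weyl_comp weyl_simple \<alpha>(1) less.prems(1) by blast
    have "x \<circ> reflection \<gamma> = ?x"
      using reflection_conj[OF weyl_orthogonal[OF less.prems(1)], of \<gamma>] \<gamma>(2) by simp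
    then have "len x < len ?x"
      using len_right_reflection(1)[OF less.prems(1) \<open>pos \<gamma>\<close>] \<gamma>(2) pos_simple[OF \<alpha>(1)] by simp
    then have "Max (len ` W) - len ?x < Max (len ` W) - len x"
      using len_bounded[OF x] by simp
    moreover have "0 < \<eta> \<bullet> \<beta>" if "pos \<beta>" "\<not> pos (?x \<beta>)" for \<beta>
    proof (cases "x \<beta> = \<alpha>")
      case True
      then have "\<beta> = \<gamma>"
        using \<gamma>(2) orthogonal_transformation_inj[OF weyl_orthogonal[OF less.prems(1)]]
        by (metis injD True)
      then show ?thesis using \<eta>\<gamma> by simp
    next
      case False
      then have "\<not> pos (x \<beta>)" using that(2) simple_reflection_pos[OF \<alpha>(1), of "x \<beta>"] by auto
      then show ?thesis using less.prems(2) that(1) by blast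
    qed
    ultimately obtain \<alpha>s where "labelled (\<lambda>\<beta>. 0 < \<eta> \<bullet> \<beta>) \<alpha>s ?x"
      "\<forall>\<alpha>\<in>\<Delta>. (word_product (rev \<alpha>s) \<circ> ?x) \<eta> \<bullet> \<alpha> < 0"
      using less.hyps[OF _ x] by blast
    then show ?thesis
      using \<alpha>(1) \<open>pos \<gamma>\<close> \<eta>\<gamma> \<gamma>(2) by (intro exI[of _ "\<alpha> # \<alpha>s"]) auto
  qed
qed

text \<open>Ascend further to the longest element: the labels are positive roots that
  \<open>x\<close> has not yet made negative, which is where \<open>P\<close> is assumed.\<close>

lemma complete_word:
  assumes "x \<in> W" "\<And>\<beta>. pos \<beta> \<Longrightarrow> pos (x \<beta>) \<Longrightarrow> P \<beta>"
  shows "\<exists>\<alpha>s. labelled P \<alpha>s x \<and> (\<forall>\<beta>. pos \<beta> \<longrightarrow> \<not> pos ((word_product (rev \<alpha>s) \<circ> x) \<beta>))"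
  using assms
proof (induction "Max (len ` W) - len x" arbitrary: x rule: less_induct)
  case less
  show ?case
  proof (cases "\<exists>\<gamma>. pos \<gamma> \<and> x \<gamma> \<in> \<Delta>")
    case False
    have "\<not> pos (x \<beta>)" if "pos \<beta>" for \<beta>
    proof
      \<comment> \<open>If no positive root is sent to a simple root, then \<open>- x rho\<close> is
        dominant, and no positive root can stay positive under \<open>x\<close>.\<close>
      assume "pos (x \<beta>)"
      have "dominant (- x rho)"
        unfolding dominant_def
      proof
        fix \<alpha> assume \<alpha>: "\<alpha> \<in> \<Delta>"
        obtain \<gamma> where \<gamma>: "\<gamma> \<in> \<Phi>" "x \<gamma> = \<alpha>"
          using weyl_root_surj[OF less.prems(1)] \<alpha> simple_subset by (metis subsetD)
        then have "\<not> pos \<gamma>" using False \<alpha> by blast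
        then have "rho \<bullet> \<gamma> \<le> 0" using \<gamma>(1) by (simp add: pos_def not_less)
        then show "0 \<le> - x rho \<bullet> \<alpha>" using weyl_inner[OF less.prems(1), of rho \<gamma>] \<gamma>(2) by simp
      qed
      from dominant_pos[OF this \<open>pos (x \<beta>)\<close>] have "rho \<bullet> \<beta> \<le> 0"
        using weyl_inner[OF less.prems(1)] by simp
      with that show False by (simp add: pos_def)
    qed
    then show ?thesis by (intro exI[of _ "[]"]) simp
  next
    case True
    then obtain \<gamma> \<alpha> where \<gamma>: "pos \<gamma>" "x \<gamma> = \<alpha>" "\<alpha> \<in> \<Delta>" by blast
    let ?x = "reflection \<alpha> \<circ> x"
    have x: "?x \<in> W" using weyl_comp weyl_simple \<gamma>(3) less.prems(1) by blast
    have "x \<circ> reflection \<gamma> = ?x"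
      using reflection_conj[OF weyl_orthogonal[OF less.prems(1)], of \<gamma>] \<gamma>(2) by simp
    then have "len x < len ?x"
      using len_right_reflection(1)[OF less.prems(1) \<gamma>(1)] \<gamma>(2) pos_simple[OF \<gamma>(3)] by simp
    then have "Max (len ` W) - len ?x < Max (len ` W) - len x"
      using len_bounded[OF x] by simp
    moreover have "P \<beta>" if "pos \<beta>" "pos (?x \<beta>)" for \<beta>
    proof (cases "pos (x \<beta>)")
      case True
      then show ?thesis using less.prems(2) that(1) by blast
    next
      case False
      have "x \<beta> \<in> \<Phi>" using weyl_root less.prems(1) pos_root that(1) by blast
      with False have "pos (- x \<beta>)" using pos_minus by blast
      moreover have "\<not> pos (reflection \<alpha> (- x \<beta>))"
        using that(2) pos_minus[of "?x \<beta>"] pos_root[OF that(2)]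
          linear_neg[OF weyl_linear[OF weyl_simple[OF \<gamma>(3)]], of "x \<beta>"] by simp
      ultimately have "- x \<beta> = \<alpha>" using simple_reflection_pos[OF \<gamma>(3)] by blast
      then have "x (- \<beta>) = x \<gamma>" using \<gamma>(2) weyl_minus[OF less.prems(1)] by simp
      then have "- \<beta> = \<gamma>"
        using orthogonal_transformation_inj[OF weyl_orthogonal[OF less.prems(1)]]
        by (metis injD)
      then show ?thesis using that(1) \<gamma>(1) pos_minus[of \<beta>] pos_root by blast
    qed
    ultimately obtain \<alpha>s where "labelled P \<alpha>s ?x"
      "\<forall>\<beta>. pos \<beta> \<longrightarrow> \<not> pos ((word_product (rev \<alpha>s) \<circ> ?x) \<beta>)"
      using less.hyps[OF _ x] by blast
    then show ?thesis
      using \<gamma> less.prems(2) pos_simple by (intro exI[of _ "\<alpha> # \<alpha>s"]) auto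
  qed
qed

text \<open>Along the edge to \<open>reflection \<beta> \<circ> p\<close> the value of \<eta> drops
  by \<open>root_pairing (p \<mu>) \<beta> * (\<eta> \<bullet> \<beta>)\<close>. For regular
  dominant \<mu> lengths decide the sign of the pairing, so no weight occurs here.\<close>

definition local_max :: "'a \<Rightarrow> ('a \<Rightarrow> 'a) \<Rightarrow> ('a \<Rightarrow> 'a) \<Rightarrow> ('a \<Rightarrow> 'a) \<Rightarrow> bool" where
  "local_max \<eta> u v p \<longleftrightarrow> le u p \<and> le p v \<and>
    (\<forall>\<beta>. pos \<beta> \<longrightarrow> le u (reflection \<beta> \<circ> p) \<longrightarrow> le (reflection \<beta> \<circ> p) v \<longrightarrow>
      (len (reflection \<beta> \<circ> p) < len p \<longleftrightarrow> \<eta> \<bullet> \<beta> < 0))"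

text \<open>Split a reduced word of the longest element so that the labels of the first part are the
  positive roots on which \<open>\<eta>\<close> is positive.  A local maximum \<open>p\<close> contributes to the leading
  coefficient, because a path from \<open>v\<close> to \<open>p\<close> cannot end, and a path from \<open>p\<close> to \<open>u\<close> cannot start,
  with a step towards larger values of \<open>\<eta>\<close>.\<close>

lemma local_max_unique:
  assumes "generic \<eta>" "local_max \<eta> u v p" "local_max \<eta> u v q"
  shows "p = q"
proof -
  let ?P = "\<lambda>\<beta>. 0 < \<eta> \<bullet> \<beta>" and ?N = "\<lambda>\<beta>. \<eta> \<bullet> \<beta> < 0"
  obtain \<alpha>s where \<alpha>s: "labelled ?P \<alpha>s id"
    "\<forall>\<alpha>\<in>\<Delta>. (word_product (rev \<alpha>s) \<circ> id) \<eta> \<bullet> \<alpha> < 0"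
    using antidominant_word[OF assms(1) weyl_id] by auto
  define x where "x = word_product (rev \<alpha>s)"
  have x: "x \<in> W"
    using word_in_weyl[of "rev \<alpha>s"] labelled_simple[OF \<alpha>s(1)] by (simp add: x_def)
  have "?N \<beta>" if "pos \<beta>" "pos (x \<beta>)" for \<beta>
  proof -
    have "dominant (- x \<eta>)"
      using \<alpha>s(2) by (auto simp: dominant_def x_def less_imp_le)
    from dominant_pos[OF this that(2)] have "\<eta> \<bullet> \<beta> \<le> 0" using weyl_inner[OF x] by simp
    moreover have "\<eta> \<bullet> \<beta> \<noteq> 0" using assms(1) pos_root[OF that(1)] by (simp add: generic_def)
    ultimately show ?thesis by simp
  qed
  then obtain \<beta>s where \<beta>s: "labelled ?N \<beta>s x"
    "\<forall>\<beta>. pos \<beta> \<longrightarrow> \<not> pos ((word_product (rev \<beta>s) \<circ> x) \<beta>)"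
    using complete_word[OF x, of ?N] by blast
  let ?w = "word_product (rev \<beta>s) \<circ> x"
  have rev: "word_product (rev (\<alpha>s @ \<beta>s)) = ?w" by (simp add: x_def)
  have longest: "longest_word (\<alpha>s @ \<beta>s)"
    unfolding longest_word_def rev
    using labelled_mono[OF \<alpha>s(1)] labelled_mono[OF \<beta>s(1)] \<beta>s(2)
    by (simp add: labelled_append x_def)
  have w: "?w \<in> W" using longest_word_weyl(2)[OF longest] rev by simp
  have uv: "u \<in> W" "v \<in> W" using assms(2) le_weyl by (auto simp: local_max_def)
  \<comment> \<open>A positive leading coefficient gives a descending path from \<open>b\<close> to
    \<open>a\<close> with \<eta>-positive labels down to \<open>z\<close> and \<eta>-negative labels
    below.\<close>
  have split: "\<exists>z i. i \<le> len b - len a \<and> z \<in> W \<and> 0 < hecke \<alpha>s b (x \<circ> z) i \<and>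
      0 < hecke \<beta>s (x \<circ> z) (?w \<circ> a) (len b - len a - i) \<and>
      (down_step ?P ^^ i) b z \<and> (down_step ?N ^^ (len b - len a - i)) z a"
    if "le a b" for a b
  proof -
    have ab: "a \<in> W" "b \<in> W" using that le_weyl by auto
    have "0 < hecke (\<alpha>s @ \<beta>s) b (?w \<circ> a) (len b - len a)"
      using hecke_longest[OF longest that] unfolding rev by simp
    then obtain z i where zi: "i \<le> len b - len a" "0 < hecke \<alpha>s b z i"
      "0 < hecke \<beta>s z (?w \<circ> a) (len b - len a - i)"
      using hecke_append_split by blast
    then obtain z' where z': "z = x \<circ> z'" "(down_step ?P ^^ i) b z'"
      using hecke_path[OF \<alpha>s(1) weyl_id ab(2), of z i] by (auto simp: x_def)
    have zW: "z' \<in> W" using down_path_le[OF z'(2) ab(2)] by blast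
    obtain a' where "?w \<circ> a = ?w \<circ> a'" "(down_step ?N ^^ (len b - len a - i)) z' a'"
      using hecke_path[OF \<beta>s(1) x zW] zi(3) z'(1) by blast
    then have "(down_step ?N ^^ (len b - len a - i)) z' a"
      using weyl_comp_cancel[OF w] by metis
    then show ?thesis using zi z' zW by blast
  qed
  have main: "0 < hecke \<alpha>s v (x \<circ> p) (len v - len p) \<and>
      0 < hecke \<beta>s (x \<circ> p) (?w \<circ> u) (len p - len u)" if lm: "local_max \<eta> u v p" for p
  proof
    have up: "le u p" and pv: "le p v" and nbr: "\<And>\<beta>. pos \<beta> \<Longrightarrow> le u (reflection \<beta> \<circ> p) \<Longrightarrow>
      le (reflection \<beta> \<circ> p) v \<Longrightarrow> len (reflection \<beta> \<circ> p) < len p \<longleftrightarrow> \<eta> \<bullet> \<beta> < 0"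
      using lm by (auto simp: local_max_def)
    obtain z i where zi: "i \<le> len v - len p" "z \<in> W" "0 < hecke \<alpha>s v (x \<circ> z) i"
      "(down_step ?P ^^ i) v z" "(down_step ?N ^^ (len v - len p - i)) z p"
      using split[OF pv] by blast
    \<comment> \<open>The last step of a nonempty lower part would come from a longer neighbour in
      [u, v] with \<eta>-negative label, against local maximality of \<open>p\<close>.\<close>
    have "len v - len p - i = 0"
    proof (rule ccontr)
      assume "len v - len p - i \<noteq> 0"
      then obtain m where "len v - len p - i = Suc m" using not0_implies_Suc by blast
      then obtain y where y: "(down_step ?N ^^ m) z y" "down_step ?N y p"
        using zi(5) by auto
      then obtain \<beta> where \<beta>: "pos \<beta>" "\<eta> \<bullet> \<beta> < 0" "p = reflection \<beta> \<circ> y" "len p < len y"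
        by (auto simp: down_step_def)
      then have y_eq: "y = reflection \<beta> \<circ> p" by simp
      have "le y z" "y \<in> W" using down_path_le[OF y(1) zi(2)] by auto
      moreover have "le z v" using down_path_le[OF zi(4) uv(2)] by blast
      moreover have "le p y"
        using left_reflection_ge[OF \<open>y \<in> W\<close> pos_root[OF \<beta>(1)]] \<beta>(3,4) by simp
      ultimately have "le u y" "le y v" using up le_trans by blast+
      then show False using nbr[OF \<beta>(1)] \<beta>(2,4) unfolding y_eq[symmetric] by simp
    qed
    then have "z = p" "i = len v - len p" using zi(1,5) by simp_all
    then show "0 < hecke \<alpha>s v (x \<circ> p) (len v - len p)" using zi(3) by (simp only:)
  next
    have up: "le u p" and pv: "le p v" and nbr: "\<And>\<beta>. pos \<beta> \<Longrightarrow> le u (reflection \<beta> \<circ> p) \<Longrightarrow>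
      le (reflection \<beta> \<circ> p) v \<Longrightarrow> len (reflection \<beta> \<circ> p) < len p \<longleftrightarrow> \<eta> \<bullet> \<beta> < 0"
      using lm by (auto simp: local_max_def)
    have p: "p \<in> W" using up le_weyl by blast
    obtain z i where zi: "i \<le> len p - len u" "z \<in> W"
      "0 < hecke \<beta>s (x \<circ> z) (?w \<circ> u) (len p - len u - i)"
      "(down_step ?P ^^ i) p z" "(down_step ?N ^^ (len p - len u - i)) z u"
      using split[OF up] by blast
    \<comment> \<open>Dually, the first step of a nonempty upper part would lead to a shorter
      neighbour with \<eta>-positive label.\<close>
    have "i = 0"
    proof (rule ccontr)
      assume "i \<noteq> 0"
      then obtain m where "i = Suc m" using not0_implies_Suc by blast
      then obtain y where y: "down_step ?P p y" "(down_step ?P ^^ m) y z"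
        using zi(4) relpowp_Suc_D2 by metis
      then obtain \<beta> where \<beta>: "pos \<beta>" "0 < \<eta> \<bullet> \<beta>" "y = reflection \<beta> \<circ> p" "len y < len p"
        by (auto simp: down_step_def)
      have yp: "le y p" using left_reflection_ge[OF p pos_root[OF \<beta>(1)]] \<beta>(3,4) by simp
      then have "le z y" using down_path_le[OF y(2)] le_weyl by blast
      moreover have "le u z" using down_path_le[OF zi(5) zi(2)] by blast
      ultimately have "le u y" "le y v" using yp pv le_trans by blast+
      then show False using nbr[OF \<beta>(1)] \<beta>(2,4) unfolding \<beta>(3) by simp
    qed
    then have "p = z" using zi(4) by simp
    then show "0 < hecke \<beta>s (x \<circ> p) (?w \<circ> u) (len p - len u)"
      using zi(3) \<open>i = 0\<close> by (simp only: diff_zero)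
  qed
  show ?thesis
  proof (rule ccontr)
    assume "p \<noteq> q"
    then have "x \<circ> p \<noteq> x \<circ> q" using weyl_comp_cancel[OF x] by blast
    moreover have len: "len u \<le> len p" "len p \<le> len v" "len u \<le> len q" "len q \<le> len v"
      using assms(2,3) le_len by (auto simp: local_max_def)
    then have "len v - len p + (len p - len u) = len v - len q + (len q - len u)" by simp
    ultimately have "2 \<le> hecke (\<alpha>s @ \<beta>s) v (?w \<circ> u) (len v - len p + (len p - len u))"
      using hecke_append_pos2 main[OF assms(2)] main[OF assms(3)] by blast
    moreover have "len v - len p + (len p - len u) = len v - len u" using len by simp
    moreover have "le u v" using assms(2) le_trans by (auto simp: local_max_def)
    ultimately show False using hecke_longest[OF longest] unfolding rev by simp
  qed
qed

subsection \<open>Faces\<close>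

definition ivl :: "('a \<Rightarrow> 'a) \<Rightarrow> ('a \<Rightarrow> 'a) \<Rightarrow> ('a \<Rightarrow> 'a) set" where
  "ivl u v = {z. le u z \<and> le z v}"

definition maximizers :: "'a \<Rightarrow> 'a \<Rightarrow> ('a \<Rightarrow> 'a) set \<Rightarrow> ('a \<Rightarrow> 'a) set" where
  "maximizers \<eta> \<mu> A = {z\<in>A. \<forall>y\<in>A. \<eta> \<bullet> y \<mu> \<le> \<eta> \<bullet> z \<mu>}"

lemma ivl_weyl: "ivl u v \<subseteq> W"
  using le_weyl by (auto simp: ivl_def)

lemma finite_ivl: "finite (ivl u v)"
  using ivl_weyl finite_weyl finite_subset by blast

lemma maximizers_nonempty:
  assumes "finite A" "A \<noteq> {}"
  shows "maximizers \<eta> \<mu> A \<noteq> {}"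
proof -
  obtain z where "z \<in> A" "\<eta> \<bullet> z \<mu> = Max ((\<lambda>z. \<eta> \<bullet> z \<mu>) ` A)"
    using assms Max_in[of "(\<lambda>z. \<eta> \<bullet> z \<mu>) ` A"] by fastforce
  then have "z \<in> maximizers \<eta> \<mu> A"
    using assms(1) by (auto simp: maximizers_def)
  then show ?thesis by blast
qed

lemma weyl_norm: "w \<in> W \<Longrightarrow> norm (w x) = norm x"
  using weyl_orthogonal orthogonal_transformation_norm by blast

lemma weyl_add_scale: "w \<in> W \<Longrightarrow> w (x + c *\<^sub>R y) = w x + c *\<^sub>R w y"
  using weyl_linear by (simp add: linear_add linear_scale)

lemma inner_reflection_comp:
  "\<eta> \<bullet> (reflection \<beta> \<circ> w) \<mu> = \<eta> \<bullet> w \<mu> - root_pairing (w \<mu>) \<beta> * (\<eta> \<bullet> \<beta>)"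
  by (simp add: inner_reflection)

lemma root_pairing_sgn:
  assumes "\<beta> \<in> \<Phi>"
  shows "0 < root_pairing x \<beta> \<longleftrightarrow> 0 < x \<bullet> \<beta>" "root_pairing x \<beta> < 0 \<longleftrightarrow> x \<bullet> \<beta> < 0"
proof -
  have "0 < \<beta> \<bullet> \<beta>" using root_inner_pos[OF assms] .
  then show "0 < root_pairing x \<beta> \<longleftrightarrow> 0 < x \<bullet> \<beta>" "root_pairing x \<beta> < 0 \<longleftrightarrow> x \<bullet> \<beta> < 0"
    unfolding root_pairing_def zero_less_divide_iff divide_less_0_iff by linarith+
qed

lemma rho_pairing:
  assumes "w \<in> W" "pos \<beta>"
  shows "0 < root_pairing (w rho) \<beta> \<longleftrightarrow> len w < len (reflection \<beta> \<circ> w)"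
    and "root_pairing (w rho) \<beta> < 0 \<longleftrightarrow> len (reflection \<beta> \<circ> w) < len w"
  using root_pairing_sgn[OF pos_root[OF assms(2)]] len_left_reflection[OF assms] by auto

text \<open>The induction removes a left descent \<open>s\<close> of the upper end, replacing \<open>[a, b]\<close> by
  \<open>[a, s b]\<close> if \<open>a < s a\<close>, and otherwise by \<open>[s a, s b]\<close> and \<open>\<eta>\<close> by \<open>s \<eta>\<close>.\<close>

lemma constant_on_interval:
  assumes "le a b" "\<And>z. z \<in> ivl a b \<Longrightarrow> \<eta> \<bullet> z rho \<le> m" "\<eta> \<bullet> a rho = m" "\<eta> \<bullet> b rho = m"
    and "z \<in> ivl a b"
  shows "\<eta> \<bullet> z rho = m"
  using assms
proof (induction "len b" arbitrary: a b \<eta> z rule: less_induct)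
  case less
  have ab: "a \<in> W" "b \<in> W" using less.prems(1) le_weyl by auto
  show ?case
  proof (cases "len b = 0")
    case True
    have "le z b" using less.prems(5) by (simp add: ivl_def)
    moreover have "le a z" using less.prems(5) by (simp add: ivl_def)
    ultimately have "z = b" using le_len_eq[OF less.prems(1)] le_antisym True by auto
    then show ?thesis using less.prems(4) by simp
  next
    case False
    then obtain \<alpha> where \<alpha>: "\<alpha> \<in> \<Delta>" "len (reflection \<alpha> \<circ> b) < len b"
      using left_descent ab(2) by blast
    let ?s = "\<lambda>w::'a \<Rightarrow> 'a. reflection \<alpha> \<circ> w" and ?k = "\<lambda>w. root_pairing (w rho) \<alpha>"
    have invol: "?s (?s w) = w" for w by simp
    have W: "?s w \<in> W" if "w \<in> W" for w using that weyl_comp weyl_simple \<alpha>(1) by blast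
    have val: "\<eta> \<bullet> ?s w rho = \<eta> \<bullet> w rho - ?k w * (\<eta> \<bullet> \<alpha>)" for w
      by (rule inner_reflection_comp)
    have k: "0 < ?k w \<longleftrightarrow> len w < len (?s w)" "?k w < 0 \<longleftrightarrow> len (?s w) < len w" if "w \<in> W" for w
      using rho_pairing[OF that pos_simple[OF \<alpha>(1)]] by auto
    have k_b: "?k b < 0" using k(2)[OF ab(2)] \<alpha>(2) by simp
    have ud: "len w < len (?s w) \<or> len (?s w) < len w" if "w \<in> W" for w
      using len_simple_left[OF that \<alpha>(1)] by auto
    have ivlW: "w \<in> W" if "le x w" for x w using that le_weyl by blast
    have sb: "le (?s b) b" using left_reflection_ge ab(2) \<alpha> simple_subset by blast
    have bound: "\<eta> \<bullet> w rho \<le> m" if "le a w" "le w b" for w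
      using less.prems(2) that by (simp add: ivl_def)
    note lift = lifting_left[OF \<alpha>(1)]
    have z: "le a z" "le z b" "z \<in> W" using less.prems(5) le_weyl by (auto simp: ivl_def)
    show ?thesis
    proof (cases "len a < len (?s a)")
      case True
      have a_sb: "le a (?s b)" using lift(3)[OF less.prems(1)] True by blast
      \<comment> \<open>Comparing \<open>a\<close> with \<open>?s a\<close> and \<open>b\<close>
        with \<open>?s b\<close> forces \<eta> to vanish on \<alpha>, because the pairings at
        \<open>a\<close> and \<open>b\<close> have opposite signs.\<close>
      have "le (?s a) b" using lift(1)[OF less.prems(1)] \<alpha>(2) by blast
      then have "\<eta> \<bullet> ?s a rho \<le> m"
        using bound left_reflection_le[OF ab(1) _ True] \<alpha>(1) simple_subset by blast
      then have "0 \<le> ?k a * (\<eta> \<bullet> \<alpha>)" using val[of a] less.prems(3) by linarith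
      then have "0 \<le> \<eta> \<bullet> \<alpha>" using k(1)[OF ab(1)] True by (simp add: zero_le_mult_iff)
      have "\<eta> \<bullet> ?s b rho \<le> m" using bound a_sb sb by blast
      then have "0 \<le> ?k b * (\<eta> \<bullet> \<alpha>)" using val[of b] less.prems(4) by linarith
      then have "\<eta> \<bullet> \<alpha> \<le> 0" using k_b by (simp add: zero_le_mult_iff)
      with \<open>0 \<le> \<eta> \<bullet> \<alpha>\<close> have 0: "\<eta> \<bullet> \<alpha> = 0" by simp
      then have val0: "\<eta> \<bullet> ?s w rho = \<eta> \<bullet> w rho" for w using val by simp
      have const: "\<eta> \<bullet> w rho = m" if "le a w" "le w (?s b)" for w
      proof (rule less.hyps[OF \<alpha>(2) a_sb _ less.prems(3)])
        show "\<eta> \<bullet> ?s b rho = m" using val0 less.prems(4) by metis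
        show "\<eta> \<bullet> y rho \<le> m" if "y \<in> ivl a (?s b)" for y
          using that bound sb le_trans by (auto simp: ivl_def)
      qed (use that in \<open>simp add: ivl_def\<close>)
      show ?thesis
      proof (cases "len z < len (?s z)")
        case True
        then have "le z (?s b)" using lift(3)[OF z(2)] by blast
        then show ?thesis using const z(1) by blast
      next
        case False
        then have "len (?s z) < len z" using ud z(3) by blast
        then have "le (?s z) (?s b)" using lift(4)[OF z(2)] by blast
        moreover have "le a (?s z)" using lift(3)[OF z(1)] True by blast
        ultimately show ?thesis using const val0 by metis
      qed
    next
      case False
      then have a_down: "len (?s a) < len a" using ud ab(1) by blast
      have sa: "le (?s a) a" using left_reflection_ge ab(1) a_down \<alpha>(1) simple_subset by blast
      have sasb: "le (?s a) (?s b)" using lift(4)[OF less.prems(1)] a_down by blast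
      let ?\<eta> = "reflection \<alpha> \<eta>"
      have val': "?\<eta> \<bullet> w rho = \<eta> \<bullet> ?s w rho" for w by (simp add: inner_reflection_left)
      have up: "le a (?s y) \<and> le (?s y) b" if "le (?s a) y" "le y (?s b)" "len y < len (?s y)" for y
        using lift(2)[OF that(1)] lift(2)[OF that(2)] \<alpha>(2) that(3) unfolding invol by blast
      \<comment> \<open>The critical \<open>y\<close> are those with \<open>?s y\<close> shorter, as
        \<open>?s y\<close> may leave [a, b]. Then \<open>y\<close> itself lies above
        \<open>a\<close>, and \<eta> \<le> 0 on \<alpha> makes \<open>?s y\<close> no better than
        \<open>y\<close>; if \<open>a\<close> is not below \<open>?s b\<close>, no such
        \<open>y\<close> exists.\<close>
      have bound': "?\<eta> \<bullet> y rho \<le> m" if y: "le (?s a) y" "le y (?s b)"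
        and neg: "\<eta> \<bullet> \<alpha> \<le> 0 \<or> \<not> le a (?s b)" for y
      proof (cases "len y < len (?s y)")
        case True
        then show ?thesis unfolding val' using up[OF y] bound by blast
      next
        case False
        have yW: "y \<in> W" using y le_weyl by blast
        with False have y_down: "len (?s y) < len y" using ud by blast
        then have "le a y" using lift(1)[OF y(1)] unfolding invol by blast
        then have "le a (?s b)" "\<eta> \<bullet> y rho \<le> m" using bound y sb le_trans by blast+
        moreover have "0 \<le> ?k y * (\<eta> \<bullet> \<alpha>)"
          using neg calculation(1) k(2)[OF yW] y_down by (simp add: zero_le_mult_iff)
        ultimately show ?thesis unfolding val' using val[of y] by linarith
      qed
      have const: "?\<eta> \<bullet> w rho = m" if neg: "\<eta> \<bullet> \<alpha> \<le> 0 \<or> \<not> le a (?s b)"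
        and w: "le (?s a) w" "le w (?s b)" for w
      proof (rule less.hyps[OF \<alpha>(2) sasb])
        show "?\<eta> \<bullet> ?s a rho = m" "?\<eta> \<bullet> ?s b rho = m"
          unfolding val' invol using less.prems(3,4) by auto
        show "?\<eta> \<bullet> y rho \<le> m" if "y \<in> ivl (?s a) (?s b)" for y
          using that bound'[OF _ _ neg] by (simp add: ivl_def)
      qed (use w in \<open>simp add: ivl_def\<close>)
      have neg: "\<eta> \<bullet> \<alpha> \<le> 0 \<or> \<not> le a (?s b)"
      proof (rule ccontr)
        assume *: "\<not> ?thesis"
        then have "\<eta> \<bullet> ?s b rho \<le> m" using bound sb by blast
        then have "0 \<le> ?k b * (\<eta> \<bullet> \<alpha>)" using val[of b] less.prems(4) by linarith
        then show False using * k_b by (simp add: zero_le_mult_iff)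
      qed
      have down: "\<eta> \<bullet> y rho = m" if y: "le a y" "le y b" "len (?s y) < len y" for y
      proof -
        have "le (?s a) (?s y)" "le (?s y) (?s b)"
          using lift(4)[OF y(1)] lift(4)[OF y(2)] a_down y(3) by auto
        from const[OF neg this] show ?thesis unfolding val' invol .
      qed
      show ?thesis
      proof (cases "len (?s z) < len z")
        case True
        then show ?thesis using down z by blast
      next
        case False
        then have z_up: "len z < len (?s z)" using ud z(3) by blast
        \<comment> \<open>Now \<open>a\<close> itself lies between \<open>?s a\<close> and
          \<open>?s b\<close>, so \<eta> also has value \<open>m\<close> at \<open>?s a\<close> and
          vanishes on \<alpha>. Hence \<open>z\<close> may be replaced by \<open>?s z\<close>, which
          is covered by \<open>down\<close>.\<close>
        then have "le z (?s b)" using lift(3)[OF z(2)] by blast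
        then have "le a (?s b)" using z(1) le_trans by blast
        from const[OF neg sa this] have "\<eta> \<bullet> ?s a rho = m" unfolding val' .
        then have "?k a * (\<eta> \<bullet> \<alpha>) = 0" using val[of a] less.prems(3) by simp
        then have "\<eta> \<bullet> \<alpha> = 0" using k(2)[OF ab(1)] a_down by auto
        then have "\<eta> \<bullet> z rho = \<eta> \<bullet> ?s z rho" using val[of z] by simp
        moreover have "le a (?s z)"
          using left_reflection_le[OF z(3) _ z_up] \<alpha>(1) simple_subset z(1) le_trans by blast
        moreover have "le (?s z) b" using lift(1)[OF z(2)] \<alpha>(2) by blast
        moreover have "len (?s (?s z)) < len (?s z)" unfolding invol using z_up .
        ultimately show ?thesis using down by metis
      qed
    qed
  qed
qed

text \<open>Adding a positive multiple of \<open>rho\<close> makes the weight regular, so lengths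
  decide strict signs at all neighbours.\<close>

lemma maximizer_local_max:
  assumes "generic \<eta>" "dominant \<mu>" "0 < c" "z \<in> maximizers \<eta> (\<mu> + c *\<^sub>R rho) (ivl u v)"
  shows "local_max \<eta> u v z"
proof -
  let ?\<mu> = "\<mu> + c *\<^sub>R rho"
  have z: "le u z" "le z v" "z \<in> W" using assms(4) le_weyl by (auto simp: maximizers_def ivl_def)
  have "len (reflection \<beta> \<circ> z) < len z \<longleftrightarrow> \<eta> \<bullet> \<beta> < 0"
    if \<beta>: "pos \<beta>" and in_ivl: "le u (reflection \<beta> \<circ> z)" "le (reflection \<beta> \<circ> z) v" for \<beta>
  proof -
    note len = len_left_reflection[OF z(3) \<beta>]
    have "\<eta> \<bullet> (reflection \<beta> \<circ> z) ?\<mu> \<le> \<eta> \<bullet> z ?\<mu>"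
      using assms(4) in_ivl unfolding maximizers_def ivl_def by blast
    then have "0 \<le> root_pairing (z ?\<mu>) \<beta> * (\<eta> \<bullet> \<beta>)"
      unfolding inner_reflection_comp by simp
    moreover have "\<eta> \<bullet> \<beta> \<noteq> 0" using assms(1) pos_root[OF \<beta>] by (simp add: generic_def)
    moreover have z\<mu>: "z ?\<mu> \<bullet> \<beta> = z \<mu> \<bullet> \<beta> + c * (z rho \<bullet> \<beta>)"
      by (simp add: weyl_add_scale[OF z(3)] inner_add_left)
    moreover have "len (reflection \<beta> \<circ> z) < len z \<Longrightarrow> root_pairing (z ?\<mu>) \<beta> < 0"
    proof -
      assume "len (reflection \<beta> \<circ> z) < len z"
      then have "z \<mu> \<bullet> \<beta> \<le> 0" "c * (z rho \<bullet> \<beta>) < 0"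
        using len(2) len(4)[OF assms(2)] assms(3) by (auto simp: mult_less_0_iff)
      then show ?thesis using root_pairing_sgn(2)[OF pos_root[OF \<beta>]] z\<mu> by simp
    qed
    moreover have "len z < len (reflection \<beta> \<circ> z) \<Longrightarrow> 0 < root_pairing (z ?\<mu>) \<beta>"
    proof -
      assume "len z < len (reflection \<beta> \<circ> z)"
      then have "0 \<le> z \<mu> \<bullet> \<beta>" "0 < c * (z rho \<bullet> \<beta>)"
        using len(1) len(3)[OF assms(2)] assms(3) by auto
      then show ?thesis using root_pairing_sgn(1)[OF pos_root[OF \<beta>]] z\<mu> by simp
    qed
    ultimately show ?thesis
      using len_left_cases[OF z(3) pos_root[OF \<beta>]] by (auto simp: zero_le_mult_iff)
  qed
  then show ?thesis using z by (simp add: local_max_def)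
qed

text \<open>For every \<epsilon> > 0 a maximizer at \<open>\<mu> + \<epsilon> *\<^sub>R rho\<close>
  is a local maximum, hence is \<open>p\<close> by uniqueness. Letting \<epsilon> tend to 0 reaches
  singular weights.\<close>

lemma local_max_greatest:
  assumes "generic \<eta>" "dominant \<mu>" "local_max \<eta> u v p" "z \<in> ivl u v"
  shows "\<eta> \<bullet> z \<mu> \<le> \<eta> \<bullet> p \<mu>"
proof -
  have "\<eta> \<bullet> z \<mu> + \<epsilon> * (\<eta> \<bullet> z rho) \<le> \<eta> \<bullet> p \<mu> + \<epsilon> * (\<eta> \<bullet> p rho)" if "0 < \<epsilon>" for \<epsilon>
  proof -
    obtain q where q: "q \<in> maximizers \<eta> (\<mu> + \<epsilon> *\<^sub>R rho) (ivl u v)"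
      using maximizers_nonempty[OF finite_ivl] assms(4) by blast
    then have "q = p"
      using maximizer_local_max[OF assms(1,2) that] local_max_unique[OF assms(1)] assms(3) by blast
    then have "\<eta> \<bullet> z (\<mu> + \<epsilon> *\<^sub>R rho) \<le> \<eta> \<bullet> p (\<mu> + \<epsilon> *\<^sub>R rho)" "p \<in> ivl u v"
      using q assms(4) by (auto simp: maximizers_def)
    moreover have "z \<in> W" "p \<in> W" using ivl_weyl assms(4) calculation(2) by blast+
    ultimately show ?thesis
      by (simp add: weyl_add_scale inner_add_right)
  qed
  then have "eventually (\<lambda>\<epsilon>. \<eta> \<bullet> z \<mu> + \<epsilon> * (\<eta> \<bullet> z rho) \<le> \<eta> \<bullet> p \<mu> + \<epsilon> * (\<eta> \<bullet> p rho)) (at_right 0)"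
    using eventually_at_right_less[of 0] by (auto elim: eventually_mono)
  then show ?thesis by (rule le_if_eventually_le_perturb)
qed

lemma rho_maximizer_local_max:
  assumes "generic \<eta>" "z \<in> maximizers \<eta> rho (ivl u v)"
  shows "local_max \<eta> u v z"
proof -
  have "dominant 0" by (simp add: dominant_def)
  from maximizer_local_max[OF assms(1) this, of 1] assms(2) show ?thesis by simp
qed

lemma eventually_generic:
  assumes "\<And>\<beta>. \<beta> \<in> \<Phi> \<Longrightarrow> \<eta> \<bullet> \<beta> \<noteq> 0 \<or> \<xi> \<bullet> \<beta> \<noteq> 0"
  shows "eventually (\<lambda>\<epsilon>. generic (\<eta> + \<epsilon> *\<^sub>R \<xi>)) (at_right 0)"
  unfolding generic_def inner_add_left inner_scaleR_left
  using assms by (intro eventually_ball_finite[OF finite_roots] ballI eventually_nonzero_perturb) blast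

lemma weyl_rho_generic:
  assumes "w \<in> W" "\<beta> \<in> \<Phi>"
  shows "w rho \<bullet> \<beta> \<noteq> 0"
proof -
  obtain \<gamma> where \<gamma>: "\<gamma> \<in> \<Phi>" "w \<gamma> = \<beta>" using weyl_root_surj assms by blast
  then have "w rho \<bullet> \<beta> = rho \<bullet> \<gamma>" using weyl_inner[OF assms(1), of rho \<gamma>] by simp
  then show ?thesis using root_pos_or_neg[OF \<gamma>(1)] by (auto simp: pos_def)
qed

text \<open>Perturbing \<open>\<eta>\<close> towards \<open>z \<rho>\<close> makes \<open>z\<close> the unique maximizer.\<close>

lemma rho_maximizer_greatest:
  assumes "dominant \<mu>" "z \<in> maximizers \<eta> rho (ivl u v)" "y \<in> ivl u v"
  shows "\<eta> \<bullet> y \<mu> \<le> \<eta> \<bullet> z \<mu>"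
proof -
  have z: "z \<in> W" "z \<in> ivl u v" using assms(2) ivl_weyl by (auto simp: maximizers_def)
  have max: "z \<in> maximizers (\<eta> + \<epsilon> *\<^sub>R z rho) rho (ivl u v)" if "0 < \<epsilon>" for \<epsilon>
  proof -
    have "\<eta> \<bullet> x rho + \<epsilon> * (z rho \<bullet> x rho) \<le> \<eta> \<bullet> z rho + \<epsilon> * (z rho \<bullet> z rho)" if "x \<in> ivl u v" for x
    proof -
      \<comment> \<open>All points \<open>x rho\<close> have the same norm, so \<open>z rho\<close>
        is extremal in its own direction.\<close>
      have "z rho \<bullet> x rho \<le> norm (z rho) * norm (x rho)" by (rule norm_cauchy_schwarz)
      also have "\<dots> = z rho \<bullet> z rho"
      proof -
        have "norm (x rho) = norm (z rho)" using weyl_norm z(1) ivl_weyl that by (metis subsetD)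
        then show ?thesis by (simp add: power2_norm_eq_inner[symmetric] power2_eq_square)
      qed
      finally have "\<epsilon> * (z rho \<bullet> x rho) \<le> \<epsilon> * (z rho \<bullet> z rho)" using \<open>0 < \<epsilon>\<close> by simp
      then show ?thesis using assms(2) that by (simp add: maximizers_def add_mono)
    qed
    then show ?thesis using z(2) by (simp add: maximizers_def inner_add_left)
  qed
  have "eventually (\<lambda>\<epsilon>. generic (\<eta> + \<epsilon> *\<^sub>R z rho)) (at_right 0)"
    using weyl_rho_generic[OF z(1)] by (intro eventually_generic) blast
  moreover have "eventually (\<lambda>\<epsilon>::real. 0 < \<epsilon>) (at_right 0)" by (rule eventually_at_right_less)
  ultimately have "eventually (\<lambda>\<epsilon>. \<eta> \<bullet> y \<mu> + \<epsilon> * (z rho \<bullet> y \<mu>) \<le> \<eta> \<bullet> z \<mu> + \<epsilon> * (z rho \<bullet> z \<mu>))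
    (at_right 0)"
  proof eventually_elim
    case (elim \<epsilon>)
    from local_max_greatest[OF elim(1) assms(1) rho_maximizer_local_max[OF elim(1) max[OF elim(2)]]
        assms(3)]
    show ?case by (simp add: inner_add_left)
  qed
  then show ?thesis by (rule le_if_eventually_le_perturb)
qed

text \<open>Neighbours with smaller value stay worse under a small perturbation; only ties, where
  \<eta> vanishes on \<beta>, are decided by \<open>c\<close>. The hypothesis admits minimal
  maximizers for \<open>c\<close> = 1 and maximal ones for \<open>c\<close> = -1.\<close>

lemma rho_maximizer_perturb:
  assumes "c \<noteq> 0" "z \<in> maximizers \<eta> rho (ivl u v)"
    and "\<And>\<beta>. pos \<beta> \<Longrightarrow> reflection \<beta> \<circ> z \<in> maximizers \<eta> rho (ivl u v) \<Longrightarrow>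
      len (reflection \<beta> \<circ> z) < len z \<longleftrightarrow> c < 0"
  shows "eventually (\<lambda>\<epsilon>. local_max (\<eta> + \<epsilon> *\<^sub>R c *\<^sub>R rho) u v z) (at_right 0)"
proof -
  let ?M = "maximizers \<eta> rho (ivl u v)"
  have z: "z \<in> W" "z \<in> ivl u v" using assms(2) ivl_weyl by (auto simp: maximizers_def)
  have "eventually (\<lambda>\<epsilon>. len (reflection \<beta> \<circ> z) < len z \<longleftrightarrow> \<eta> \<bullet> \<beta> + \<epsilon> * (c * (rho \<bullet> \<beta>)) < 0)
    (at_right 0)" if \<beta>: "pos \<beta>" and in_ivl: "reflection \<beta> \<circ> z \<in> ivl u v" for \<beta>
  proof -
    let ?k = "root_pairing (z rho) \<beta>"
    have val: "\<eta> \<bullet> (reflection \<beta> \<circ> z) rho = \<eta> \<bullet> z rho - ?k * (\<eta> \<bullet> \<beta>)"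
      by (rule inner_reflection_comp)
    have rho: "0 < rho \<bullet> \<beta>" using \<beta> by (simp add: pos_def)
    note k = rho_pairing[OF z(1) \<beta>]
    have k0: "?k \<noteq> 0" using k len_left_cases[OF z(1) pos_root[OF \<beta>]] by auto
    show ?thesis
    proof (cases "reflection \<beta> \<circ> z \<in> ?M")
      case True
      then have "\<eta> \<bullet> z rho \<le> \<eta> \<bullet> (reflection \<beta> \<circ> z) rho"
        "\<eta> \<bullet> (reflection \<beta> \<circ> z) rho \<le> \<eta> \<bullet> z rho"
        using assms(2) z(2) in_ivl unfolding maximizers_def by blast+
      then have "\<eta> \<bullet> \<beta> = 0" using val k0 by simp
      moreover have "\<epsilon> * (c * (rho \<bullet> \<beta>)) < 0 \<longleftrightarrow> c < 0" if "0 < \<epsilon>" for \<epsilon> :: real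
        using that rho by (simp add: mult_less_0_iff)
      ultimately show ?thesis
        using assms(3)[OF \<beta> True] eventually_at_right_less[of 0] by (auto elim: eventually_mono)
    next
      case False
      have "\<eta> \<bullet> (reflection \<beta> \<circ> z) rho < \<eta> \<bullet> z rho"
      proof (rule ccontr)
        assume "\<not> ?thesis"
        then have "reflection \<beta> \<circ> z \<in> ?M"
          using assms(2) in_ivl unfolding maximizers_def by fastforce
        with False show False ..
      qed
      then have "0 < ?k * (\<eta> \<bullet> \<beta>)" using val by simp
      then consider "0 < ?k" "0 < \<eta> \<bullet> \<beta>" | "?k < 0" "\<eta> \<bullet> \<beta> < 0"
        by (auto simp: zero_less_mult_iff)
      then show ?thesis
      proof cases
        case 1
        then show ?thesis
          using k(1) eventually_less_perturb[of 0 "\<eta> \<bullet> \<beta>" 0 "c * (rho \<bullet> \<beta>)"]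
          by (auto elim: eventually_mono)
      next
        case 2
        then show ?thesis
          using k(2) eventually_less_perturb[of "\<eta> \<bullet> \<beta>" 0 "c * (rho \<bullet> \<beta>)" 0]
          by (auto elim: eventually_mono)
      qed
    qed
  qed
  then have "eventually (\<lambda>\<epsilon>. \<forall>\<beta>\<in>{\<beta>\<in>\<Phi>. pos \<beta> \<and> reflection \<beta> \<circ> z \<in> ivl u v}.
    len (reflection \<beta> \<circ> z) < len z \<longleftrightarrow> \<eta> \<bullet> \<beta> + \<epsilon> * (c * (rho \<bullet> \<beta>)) < 0) (at_right 0)"
    using finite_roots by (intro eventually_ball_finite) auto
  then show ?thesis
  proof eventually_elim
    case (elim \<epsilon>)
    then show ?case
      using z(2) pos_root by (simp add: local_max_def inner_add_left ivl_def mult.assoc)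
  qed
qed

lemma rho_maximizers_interval:
  assumes "le u v"
  obtains a b where "le a b" "maximizers \<eta> rho (ivl u v) = ivl a b"
proof -
  let ?M = "maximizers \<eta> rho (ivl u v)"
  have M_ivl: "?M \<subseteq> ivl u v" by (auto simp: maximizers_def)
  have MW: "?M \<subseteq> W" using M_ivl ivl_weyl by blast
  have gen: "eventually (\<lambda>\<epsilon>. generic (\<eta> + \<epsilon> *\<^sub>R c *\<^sub>R rho)) (at_right 0)" if "c \<noteq> 0" for c
    using that weyl_rho_generic[OF weyl_id] by (intro eventually_generic) simp
  have uniq: "z = z'" if "c \<noteq> 0"
    "eventually (\<lambda>\<epsilon>. local_max (\<eta> + \<epsilon> *\<^sub>R c *\<^sub>R rho) u v z) (at_right 0)"
    "eventually (\<lambda>\<epsilon>. local_max (\<eta> + \<epsilon> *\<^sub>R c *\<^sub>R rho) u v z') (at_right 0)" for c z z'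
  proof -
    have "eventually (\<lambda>\<epsilon>::real. z = z') (at_right 0)"
      using gen[OF that(1)] that(2,3) by eventually_elim (rule local_max_unique)
    then show ?thesis by simp
  qed
  have min: "\<exists>a\<in>?M. le a z \<and> eventually (\<lambda>\<epsilon>. local_max (\<eta> + \<epsilon> *\<^sub>R 1 *\<^sub>R rho) u v a) (at_right 0)"
    if "z \<in> ?M" for z
  proof -
    have "z \<in> ?M \<and> le z z" using that le_refl MW by blast
    then obtain a where a: "a \<in> ?M" "le a z" "\<And>y. y \<in> ?M \<Longrightarrow> le y z \<Longrightarrow> len a \<le> len y"
      using ex_has_least_nat[of "\<lambda>y. y \<in> ?M \<and> le y z" z len] by blast
    have "len (reflection \<beta> \<circ> a) < len a \<longleftrightarrow> (1::real) < 0"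
      if "pos \<beta>" "reflection \<beta> \<circ> a \<in> ?M" for \<beta>
    proof -
      have "\<not> len (reflection \<beta> \<circ> a) < len a"
      proof
        assume l: "len (reflection \<beta> \<circ> a) < len a"
        then have "le (reflection \<beta> \<circ> a) z"
          using left_reflection_ge pos_root[OF that(1)] a(1,2) MW le_trans by blast
        from a(3)[OF that(2) this] l show False by simp
      qed
      then show ?thesis by simp
    qed
    from rho_maximizer_perturb[OF _ a(1) this] a(1,2) show ?thesis by auto
  qed
  have max: "\<exists>b\<in>?M. le z b \<and> eventually (\<lambda>\<epsilon>. local_max (\<eta> + \<epsilon> *\<^sub>R (- 1) *\<^sub>R rho) u v b) (at_right 0)"
    if "z \<in> ?M" for z
  proof -
    have "z \<in> ?M \<and> le z z" using that le_refl MW by blast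
    moreover have "\<forall>y. y \<in> ?M \<and> le z y \<longrightarrow> len y < Suc (Max (len ` W))"
      using len_bounded le_weyl by (auto simp: less_Suc_eq_le)
    ultimately obtain b where b: "b \<in> ?M" "le z b" "\<And>y. y \<in> ?M \<Longrightarrow> le z y \<Longrightarrow> len y \<le> len b"
      using ex_has_greatest_nat[of "\<lambda>y. y \<in> ?M \<and> le z y" z len] by blast
    have "len (reflection \<beta> \<circ> b) < len b \<longleftrightarrow> (- 1::real) < 0"
      if "pos \<beta>" "reflection \<beta> \<circ> b \<in> ?M" for \<beta>
    proof -
      have "\<not> len b < len (reflection \<beta> \<circ> b)"
      proof
        assume l: "len b < len (reflection \<beta> \<circ> b)"
        then have "le z (reflection \<beta> \<circ> b)"
          using left_reflection_le pos_root[OF that(1)] b(1,2) MW le_trans by blast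
        from b(3)[OF that(2) this] l show False by simp
      qed
      then show ?thesis using len_left_cases[of b \<beta>] b(1) MW pos_root[OF that(1)] by auto
    qed
    from rho_maximizer_perturb[OF _ b(1) this] b(1,2) show ?thesis by auto
  qed
  have "u \<in> ivl u v" using assms le_refl le_weyl by (auto simp: ivl_def)
  then obtain z where z: "z \<in> ?M"
    using maximizers_nonempty[OF finite_ivl, of u v \<eta> rho] by blast
  obtain a where a: "a \<in> ?M" "eventually (\<lambda>\<epsilon>. local_max (\<eta> + \<epsilon> *\<^sub>R 1 *\<^sub>R rho) u v a) (at_right 0)"
    using min[OF z] by blast
  obtain b where b: "b \<in> ?M" "eventually (\<lambda>\<epsilon>. local_max (\<eta> + \<epsilon> *\<^sub>R (- 1) *\<^sub>R rho) u v b) (at_right 0)"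
    using max[OF z] by blast
  \<comment> \<open>The minimal maximizer found below \<open>y\<close> is a local maximum of the
    same perturbations as \<open>a\<close>, so the two coincide.\<close>
  have le_a: "le a y" if "y \<in> ?M" for y
    using min[OF that] uniq[OF _ a(2)] by auto
  have le_b: "le y b" if "y \<in> ?M" for y
    using max[OF that] uniq[OF _ b(2)] by auto
  have sub: "ivl a b \<subseteq> ivl u v"
    using a(1) b(1) M_ivl le_trans by (fastforce simp: ivl_def)
  have "?M = ivl a b"
  proof
    show "?M \<subseteq> ivl a b" using le_a le_b by (auto simp: ivl_def)
    show "ivl a b \<subseteq> ?M"
    proof
      fix y assume y: "y \<in> ivl a b"
      have "\<eta> \<bullet> y rho = \<eta> \<bullet> a rho"
      proof (rule constant_on_interval[OF le_a[OF b(1)] _ refl _ y])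
        show "\<eta> \<bullet> x rho \<le> \<eta> \<bullet> a rho" if "x \<in> ivl a b" for x
          using that sub a(1) by (auto simp: maximizers_def)
        show "\<eta> \<bullet> b rho = \<eta> \<bullet> a rho"
          using a(1) b(1) by (auto simp: maximizers_def intro: antisym)
      qed
      then show "y \<in> ?M" using y sub a(1) by (auto simp: maximizers_def)
    qed
  qed
  with that le_a[OF b(1)] show ?thesis by blast
qed

text \<open>A weight outside the hull is separated from it by some \<open>\<xi>\<close>; the maximizer of a generic
  perturbation of \<open>\<eta>\<close> in direction \<open>\<xi>\<close> lies in the hull and contradicts this.\<close>

lemma hull_of_rho_maximizers:
  assumes "dominant \<mu>" "y \<in> maximizers \<eta> \<mu> (ivl u v)"
  shows "y \<mu> \<in> convex hull ((\<lambda>z. z \<mu>) ` maximizers \<eta> rho (ivl u v))"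
proof (rule ccontr)
  let ?M = "maximizers \<eta> rho (ivl u v)"
  let ?H = "convex hull ((\<lambda>z. z \<mu>) ` ?M)"
  assume out: "y \<mu> \<notin> ?H"
  have y: "y \<in> ivl u v" using assms(2) by (simp add: maximizers_def)
  have finM: "finite ?M" using finite_ivl by (auto simp: maximizers_def)
  then have "closed ?H" by (simp add: compact_imp_closed finite_imp_compact_convex_hull)
  then obtain \<zeta> b where \<zeta>: "\<zeta> \<bullet> y \<mu> < b" "\<And>x. x \<in> ?H \<Longrightarrow> b < \<zeta> \<bullet> x"
    using separating_hyperplane_closed_point[OF convex_convex_hull _ out] by blast
  have \<zeta>M: "\<zeta> \<bullet> y \<mu> < \<zeta> \<bullet> x \<mu>" if "x \<in> ?M" for x
    using \<zeta>(1) \<zeta>(2)[of "x \<mu>"] that hull_subset[of "(\<lambda>z. z \<mu>) ` ?M" convex] by fastforce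
  have "eventually (\<lambda>\<kappa>. generic (\<zeta> + \<kappa> *\<^sub>R rho)) (at_right 0)"
    using weyl_rho_generic[OF weyl_id] by (intro eventually_generic) simp
  moreover have "eventually (\<lambda>\<kappa>. \<forall>x\<in>?M. \<zeta> \<bullet> y \<mu> + \<kappa> * (rho \<bullet> y \<mu>) < \<zeta> \<bullet> x \<mu> + \<kappa> * (rho \<bullet> x \<mu>))
    (at_right 0)"
    using \<zeta>M by (intro eventually_ball_finite[OF finM] ballI eventually_less_perturb)
  ultimately have "eventually (\<lambda>\<kappa>. generic (\<zeta> + \<kappa> *\<^sub>R rho) \<and>
    (\<forall>x\<in>?M. (\<zeta> + \<kappa> *\<^sub>R rho) \<bullet> y \<mu> < (\<zeta> + \<kappa> *\<^sub>R rho) \<bullet> x \<mu>)) (at_right 0)"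
    by eventually_elim (simp add: inner_add_left)
  then obtain \<kappa> where \<kappa>: "generic (\<zeta> + \<kappa> *\<^sub>R rho)"
    "\<And>x. x \<in> ?M \<Longrightarrow> (\<zeta> + \<kappa> *\<^sub>R rho) \<bullet> y \<mu> < (\<zeta> + \<kappa> *\<^sub>R rho) \<bullet> x \<mu>"
    using eventually_happens'[OF trivial_limit_at_right_real] by blast
  \<comment> \<open>Separation puts \<open>y \<mu>\<close> on the smaller side, hence the sign;
    \<kappa> makes \<xi> generic, so that \<eta> + \<epsilon> \<xi> is generic for small \<epsilon>
    whatever \<eta> is.\<close>
  define \<xi> where "\<xi> = - (\<zeta> + \<kappa> *\<^sub>R rho)"
  have \<xi>_gen: "\<xi> \<bullet> \<beta> \<noteq> 0" if "\<beta> \<in> \<Phi>" for \<beta>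
    using \<kappa>(1) that unfolding generic_def \<xi>_def inner_minus_left by simp
  have \<xi>: "\<xi> \<bullet> x \<mu> < \<xi> \<bullet> y \<mu>" if "x \<in> ?M" for x
    using \<kappa>(2)[OF that] unfolding \<xi>_def inner_minus_left by simp
  obtain x0 where x0: "x0 \<in> ?M" using maximizers_nonempty[OF finite_ivl] y by blast
  have "eventually (\<lambda>\<epsilon>. \<forall>z\<in>ivl u v - ?M. \<eta> \<bullet> z rho + \<epsilon> * (\<xi> \<bullet> z rho) < \<eta> \<bullet> x0 rho + \<epsilon> * (\<xi> \<bullet> x0 rho))
    (at_right 0)"
  proof (intro eventually_ball_finite ballI eventually_less_perturb)
    fix z assume "z \<in> ivl u v - ?M"
    then obtain x where "x \<in> ivl u v" "\<eta> \<bullet> z rho < \<eta> \<bullet> x rho"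
      by (auto simp: maximizers_def not_le)
    then show "\<eta> \<bullet> z rho < \<eta> \<bullet> x0 rho" using x0 by (fastforce simp: maximizers_def)
  qed (simp add: finite_ivl)
  moreover have "eventually (\<lambda>\<epsilon>. generic (\<eta> + \<epsilon> *\<^sub>R \<xi>)) (at_right 0)"
    using \<xi>_gen by (intro eventually_generic) blast
  moreover have "eventually (\<lambda>\<epsilon>::real. 0 < \<epsilon>) (at_right 0)" by (rule eventually_at_right_less)
  ultimately have "eventually (\<lambda>\<epsilon>. 0 < \<epsilon> \<and> generic (\<eta> + \<epsilon> *\<^sub>R \<xi>) \<and>
    (\<forall>z\<in>ivl u v - ?M. (\<eta> + \<epsilon> *\<^sub>R \<xi>) \<bullet> z rho < (\<eta> + \<epsilon> *\<^sub>R \<xi>) \<bullet> x0 rho)) (at_right 0)"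
    by eventually_elim (simp add: inner_add_left)
  then obtain \<epsilon> where \<epsilon>: "0 < \<epsilon>" "generic (\<eta> + \<epsilon> *\<^sub>R \<xi>)"
    "\<And>z. z \<in> ivl u v \<Longrightarrow> z \<notin> ?M \<Longrightarrow> (\<eta> + \<epsilon> *\<^sub>R \<xi>) \<bullet> z rho < (\<eta> + \<epsilon> *\<^sub>R \<xi>) \<bullet> x0 rho"
    using eventually_happens'[OF trivial_limit_at_right_real] by blast
  obtain p where p: "p \<in> maximizers (\<eta> + \<epsilon> *\<^sub>R \<xi>) rho (ivl u v)"
    using maximizers_nonempty[OF finite_ivl] y by blast
  have pM: "p \<in> ?M"
    using p \<epsilon>(3)[of p] x0 unfolding maximizers_def by fastforce
  have "(\<eta> + \<epsilon> *\<^sub>R \<xi>) \<bullet> y \<mu> \<le> (\<eta> + \<epsilon> *\<^sub>R \<xi>) \<bullet> p \<mu>"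
    using local_max_greatest[OF \<epsilon>(2) assms(1) rho_maximizer_local_max[OF \<epsilon>(2) p] y] .
  \<comment> \<open>As \<open>y\<close> is optimal for \<eta> at \<mu>, the perturbed inequality
    passes to \<xi>, against the separation.\<close>
  moreover have "\<eta> \<bullet> p \<mu> \<le> \<eta> \<bullet> y \<mu>"
    using assms(2) pM by (simp add: maximizers_def)
  ultimately have "\<epsilon> * (\<xi> \<bullet> y \<mu>) \<le> \<epsilon> * (\<xi> \<bullet> p \<mu>)" by (simp add: inner_add_left)
  then show False using \<xi>[OF pM] \<epsilon>(1) by simp
qed

text \<open>At a singular \<mu> there may be more maximizers than at \<open>rho\<close>, but their
  points have the same hull, and the face is that hull.\<close>

lemma face_eq_hull_interval:
  assumes "dominant \<mu>" "le u v" "F face_of convex hull ((\<lambda>z. z \<mu>) ` ivl u v)" "F \<noteq> {}"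
  obtains a b where "le a b" "F = convex hull ((\<lambda>z. z \<mu>) ` ivl a b)"
proof -
  let ?S = "(\<lambda>z. z \<mu>) ` ivl u v"
  obtain \<eta> m where \<eta>: "\<And>x. x \<in> ?S \<Longrightarrow> \<eta> \<bullet> x \<le> m" "F = convex hull {x\<in>?S. \<eta> \<bullet> x = m}"
    "{x\<in>?S. \<eta> \<bullet> x = m} \<noteq> {}"
    using face_of_convex_hull_finite_exposed[OF _ assms(3,4)] finite_ivl by blast
  let ?M = "maximizers \<eta> rho (ivl u v)"
  have max_eq: "{x\<in>?S. \<eta> \<bullet> x = m} = (\<lambda>z. z \<mu>) ` maximizers \<eta> \<mu> (ivl u v)"
    using \<eta>(1,3) by (fastforce simp: maximizers_def)
  obtain a b where ab: "le a b" "?M = ivl a b"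
    using rho_maximizers_interval[OF assms(2)] by blast
  have "?M \<subseteq> maximizers \<eta> \<mu> (ivl u v)"
    using rho_maximizer_greatest[OF assms(1)] by (auto simp: maximizers_def)
  then have "convex hull ((\<lambda>z. z \<mu>) ` ?M) \<subseteq> F"
    unfolding \<eta>(2) max_eq by (intro hull_mono) blast
  moreover have "F \<subseteq> convex hull ((\<lambda>z. z \<mu>) ` ?M)"
    unfolding \<eta>(2) max_eq
    by (intro hull_minimal convex_convex_hull) (use hull_of_rho_maximizers[OF assms(1)] in blast)
  ultimately have "F = convex hull ((\<lambda>z. z \<mu>) ` ?M)" by (rule antisym[rotated])
  then show ?thesis using that[OF ab(1)] unfolding ab(2) by blast
qed

section \<open>Return to minimal coset representatives\<close>

lemma parabolic_rho_fixed:
  assumes "x \<in> parabolic_weyl_group J" "J \<subseteq> \<Delta>"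
  shows "x (parabolic_rho \<Delta> J) = parabolic_rho \<Delta> J"
  using assms(1) unfolding parabolic_weyl_group_def
proof induction
  case (step \<beta> w)
  then show ?case
    using assms(2) by (auto simp: reflection_def root_pairing_def parabolic_rho_inner)
qed simp

text \<open>Descend from \<open>b \<circ> x\<close> by right descents in \<open>J\<close>. Once none
  is left, \<open>x\<close> sends all simple roots to positive ones and is \<open>id\<close>:
  outside \<open>J\<close> this is seen from the fixed weight, inside \<open>J\<close> from
  positivity of \<open>b\<close> on \<open>J\<close>.\<close>

lemma min_coset_repsI:
  assumes "J \<subseteq> \<Delta>" "b \<in> W" "\<And>\<alpha>. \<alpha> \<in> J \<Longrightarrow> \<not> len (b \<circ> reflection \<alpha>) < len b"
  shows "b \<in> min_coset_reps \<Phi> \<Delta> J"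
proof -
  let ?\<mu> = "parabolic_rho \<Delta> J"
  have JW: "parabolic_weyl_group J \<subseteq> W"
    unfolding parabolic_weyl_group_def weyl_group_simple by (rule reflection_group_mono[OF assms(1)])
  \<comment> \<open>A positive root orthogonal to \<open>?\<mu>\<close> involves only simple roots
    in \<open>J\<close>, so \<open>w\<close> sends it to a nonnegative combination of positive
    roots.\<close>
  have pos_J: "pos (w \<beta>)" if w: "w \<in> W" "\<And>\<alpha>. \<alpha> \<in> J \<Longrightarrow> pos (w \<alpha>)" and \<beta>: "pos \<beta>" "?\<mu> \<bullet> \<beta> = 0" for w \<beta>
  proof -
    obtain c where c: "\<beta> = (\<Sum>\<alpha>\<in>\<Delta>. c \<alpha> *\<^sub>R \<alpha>)" "\<And>\<alpha>. \<alpha> \<in> \<Delta> \<Longrightarrow> 0 \<le> c \<alpha>"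
      using pos_expansion \<beta>(1) by metis
    have "(\<Sum>\<alpha>\<in>\<Delta>. c \<alpha> * (?\<mu> \<bullet> \<alpha>)) = 0"
      using \<beta>(2) by (simp add: c(1) inner_sum_right)
    moreover have "0 \<le> c \<alpha> * (?\<mu> \<bullet> \<alpha>)" if "\<alpha> \<in> \<Delta>" for \<alpha>
      using c(2)[OF that] dominant_parabolic_rho that by (auto simp: dominant_def)
    ultimately have zero: "c \<alpha> * (?\<mu> \<bullet> \<alpha>) = 0" if "\<alpha> \<in> \<Delta>" for \<alpha>
      using sum_nonneg_eq_0_iff[OF finite_simple, of "\<lambda>\<alpha>. c \<alpha> * (?\<mu> \<bullet> \<alpha>)"] that by blast
    have outside: "c \<alpha> = 0" if "\<alpha> \<in> \<Delta>" "\<alpha> \<notin> J" for \<alpha>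
    proof -
      have "?\<mu> \<bullet> \<alpha> \<noteq> 0"
        using that root_inner_pos[of \<alpha>] simple_subset by (auto simp: parabolic_rho_inner)
      then show ?thesis using zero[OF that(1)] by simp
    qed
    have "w \<beta> = (\<Sum>\<alpha>\<in>\<Delta>. c \<alpha> *\<^sub>R w \<alpha>)"
      using weyl_linear[OF w(1)] by (subst c(1)) (simp add: linear_sum linear_scale)
    then have "rho \<bullet> w \<beta> = (\<Sum>\<alpha>\<in>\<Delta>. c \<alpha> * (rho \<bullet> w \<alpha>))"
      by (simp add: inner_sum_right)
    moreover have "0 \<le> c \<alpha> * (rho \<bullet> w \<alpha>)" if "\<alpha> \<in> \<Delta>" for \<alpha>
      using c(2)[OF that] outside[OF that] w(2)[of \<alpha>] by (cases "\<alpha> \<in> J") (auto simp: pos_def)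
    ultimately have "0 \<le> rho \<bullet> w \<beta>" by (simp add: sum_nonneg)
    then show ?thesis
      using root_pos_or_neg[of "w \<beta>"] weyl_root[OF w(1) pos_root[OF \<beta>(1)]]
      by (auto simp: pos_def)
  qed
  have bJ: "pos (b \<alpha>)" if "\<alpha> \<in> J" for \<alpha>
    using assms(3)[OF that] len_right_reflection(2)[OF assms(2)] pos_simple that assms(1) by blast
  have "le b (b \<circ> x)" if "x \<in> parabolic_weyl_group J" for x
    using that
  proof (induction "len (b \<circ> x)" arbitrary: x rule: less_induct)
    case less
    have x: "x \<in> W" using less.prems JW by blast
    have bx: "b \<circ> x \<in> W" using weyl_comp assms(2) x by blast
    show ?case
    proof (cases "\<exists>\<alpha>\<in>J. len (b \<circ> x \<circ> reflection \<alpha>) < len (b \<circ> x)")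
      case True
      then obtain \<alpha> where \<alpha>: "\<alpha> \<in> J" "len (b \<circ> x \<circ> reflection \<alpha>) < len (b \<circ> x)" by blast
      have "x \<circ> reflection \<alpha> \<in> parabolic_weyl_group J"
        using less.prems \<alpha>(1) reflection_group_comp reflection_group_reflection
        unfolding parabolic_weyl_group_def by blast
      from less.hyps[OF _ this] \<alpha>(2) have "le b (b \<circ> x \<circ> reflection \<alpha>)"
        unfolding comp_assoc by blast
      moreover have "le (b \<circ> x \<circ> reflection \<alpha>) (b \<circ> x)"
        using right_reflection_ge[OF bx _ \<alpha>(2)] \<alpha>(1) assms(1) simple_subset by blast
      ultimately show ?thesis by (rule le_trans)
    next
      case False
      have bxJ: "pos ((b \<circ> x) \<alpha>)" if "\<alpha> \<in> J" for \<alpha>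
        using False len_right_reflection(2)[OF bx] pos_simple that assms(1) by blast
      have "pos (x \<alpha>)" if \<alpha>: "\<alpha> \<in> \<Delta>" for \<alpha>
      proof (cases "\<alpha> \<in> J")
        case True
        have root: "x \<alpha> \<in> \<Phi>" using weyl_root x \<alpha> simple_subset by blast
        have "?\<mu> \<bullet> x \<alpha> = x ?\<mu> \<bullet> x \<alpha>" using parabolic_rho_fixed[OF less.prems assms(1)] by simp
        also have "\<dots> = 0" using weyl_inner[OF x] True \<alpha> by (simp add: parabolic_rho_inner)
        finally have 0: "?\<mu> \<bullet> (- x \<alpha>) = 0" by simp
        show ?thesis
        proof (rule ccontr)
          assume "\<not> ?thesis"
          then have "pos (- x \<alpha>)" using pos_minus[OF root] by blast
          then have "pos (b (- x \<alpha>))" using pos_J[OF assms(2) bJ _ 0] by blast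
          then have "pos (- b (x \<alpha>))" using weyl_minus[OF assms(2)] by simp
          then show False using bxJ[OF True] pos_minus[of "b (x \<alpha>)"] pos_root by auto
        qed
      next
        case False
        have "?\<mu> \<bullet> x \<alpha> = x ?\<mu> \<bullet> x \<alpha>" using parabolic_rho_fixed[OF less.prems assms(1)] by simp
        also have "\<dots> = (\<alpha> \<bullet> \<alpha>) / 2" using weyl_inner[OF x] False \<alpha> by (simp add: parabolic_rho_inner)
        also have "\<dots> > 0" using root_inner_pos[of \<alpha>] \<alpha> simple_subset by auto
        finally show ?thesis
          using dominant_inner_pos[OF dominant_parabolic_rho] weyl_root x \<alpha> simple_subset by blast
      qed
      then have "x = id" using weyl_eq_id[OF x] by blast
      then show ?thesis using le_refl[OF assms(2)] by simp
    qed
  qed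
  then show ?thesis
    using assms(2) le_len by (auto simp: min_coset_reps_def)
qed

text \<open>Right multiplication by a simple reflection in \<open>J\<close> does not change \<open>z \<rho>\<^sub>J\<close>, so right
  descents of the upper end in \<open>J\<close> can be removed one by one.\<close>

lemma interval_image_min_coset_rep:
  assumes "J \<subseteq> \<Delta>" "le a b"
  shows "\<exists>a' b'. le a' b' \<and> b' \<in> min_coset_reps \<Phi> \<Delta> J \<and>
    (\<lambda>z. z (parabolic_rho \<Delta> J)) ` ivl a' b' = (\<lambda>z. z (parabolic_rho \<Delta> J)) ` ivl a b"
  using assms(2)
proof (induction "len b" arbitrary: a b rule: less_induct)
  case less
  let ?\<mu> = "parabolic_rho \<Delta> J"
  have ab: "a \<in> W" "b \<in> W" using less.prems le_weyl by auto
  show ?case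
  proof (cases "\<exists>\<alpha>\<in>J. len (b \<circ> reflection \<alpha>) < len b")
    case False
    then show ?thesis using min_coset_repsI[OF assms(1) ab(2)] less.prems by blast
  next
    case True
    then obtain \<alpha> where \<alpha>: "\<alpha> \<in> J" "\<alpha> \<in> \<Delta>" "\<alpha> \<in> \<Phi>" "len (b \<circ> reflection \<alpha>) < len b"
      using assms(1) simple_subset by blast
    let ?r = "\<lambda>w::'a \<Rightarrow> 'a. w \<circ> reflection \<alpha>"
    have invol: "?r (?r w) = w" for w by simp
    have ud: "len w < len (?r w) \<or> len (?r w) < len w" if "w \<in> W" for w
      using len_right_cases[OF that \<alpha>(3)] .
    have "reflection \<alpha> ?\<mu> = ?\<mu>"
      using \<alpha>(1,2) by (simp add: reflection_def root_pairing_def parabolic_rho_inner)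
    then have fixed: "?r w ?\<mu> = w ?\<mu>" for w by simp
    note lift = lifting_right[OF \<alpha>(2)]
    have rb: "le (?r b) b" using right_reflection_ge ab(2) \<alpha> by blast
    \<comment> \<open>The shorter of \<open>a\<close> and \<open>?r a\<close>; with this choice
      lifting puts \<open>a'\<close> below \<open>?r b\<close> in both cases.\<close>
    define a' where "a' = (if len a < len (?r a) then a else ?r a)"
    have a'b: "le a' (?r b)" and a'a: "le a' a"
      using lift(3,4)[OF less.prems] ud[OF ab(1)] le_refl[OF ab(1)]
        right_reflection_ge[OF ab(1) \<alpha>(3)] unfolding a'_def by auto
    have "(\<lambda>z. z ?\<mu>) ` ivl a' (?r b) = (\<lambda>z. z ?\<mu>) ` ivl a b"
    proof
      show "(\<lambda>z. z ?\<mu>) ` ivl a b \<subseteq> (\<lambda>z. z ?\<mu>) ` ivl a' (?r b)"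
      proof (rule image_subsetI)
        fix z assume "z \<in> ivl a b"
        then have z: "le a z" "le z b" "z \<in> W" using le_weyl by (auto simp: ivl_def)
        show "z ?\<mu> \<in> (\<lambda>z. z ?\<mu>) ` ivl a' (?r b)"
        proof (cases "len z < len (?r z)")
          case True
          then have "z \<in> ivl a' (?r b)"
            using lift(3)[OF z(2)] le_trans[OF a'a z(1)] by (simp add: ivl_def)
          then show ?thesis by blast
        next
          case False
          then have "len (?r z) < len z" using ud z(3) by blast
          then have "le (?r z) (?r b)" using lift(4)[OF z(2)] by blast
          moreover have "le a' (?r z)"
            using lift(3,4)[OF z(1)] ud[OF ab(1)] unfolding a'_def by auto
          ultimately have "?r z \<in> ivl a' (?r b)" by (simp add: ivl_def)
          then show ?thesis using fixed[of z] by (metis imageI)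
        qed
      qed
      show "(\<lambda>z. z ?\<mu>) ` ivl a' (?r b) \<subseteq> (\<lambda>z. z ?\<mu>) ` ivl a b"
      proof (rule image_subsetI)
        fix z assume "z \<in> ivl a' (?r b)"
        then have z: "le a' z" "le z (?r b)" "z \<in> W" using le_weyl by (auto simp: ivl_def)
        have zb: "le z b" using le_trans[OF z(2) rb] .
        show "z ?\<mu> \<in> (\<lambda>z. z ?\<mu>) ` ivl a b"
        proof (cases "len a < len (?r a)")
          case True
          then have "z \<in> ivl a b" using z(1) zb by (simp add: ivl_def a'_def)
          then show ?thesis by blast
        next
          case False
          \<comment> \<open>The longer of \<open>z\<close> and \<open>?r z\<close> lies above
            \<open>a\<close>, and both give the same point.\<close>
          then have z1: "le (?r a) z" using z(1) by (simp add: a'_def)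
          show ?thesis
          proof (cases "len z < len (?r z)")
            case True
            then have "le a (?r z)" "le (?r z) b"
              using lift(2)[OF z1] lift(2)[OF z(2)] \<alpha>(4) unfolding invol by auto
            then have "?r z \<in> ivl a b" by (simp add: ivl_def)
            then show ?thesis using fixed[of z] by (metis imageI)
          next
            case False
            then have "len (?r z) < len z" using ud z(3) by blast
            then have "le a z" using lift(1)[OF z1] unfolding invol by blast
            then show ?thesis using zb by (auto simp: ivl_def)
          qed
        qed
      qed
    qed
    then show ?thesis using less.hyps[OF \<alpha>(4) a'b] by simp
  qed
qed

lemma bruhat_interval_polytope_eq:
  "bruhat_interval_polytope \<Phi> \<Delta> J u v = convex hull ((\<lambda>z. z (parabolic_rho \<Delta> J)) ` ivl u v)"
  unfolding bruhat_interval_polytope_def ivl_def by (rule arg_cong[where f = "(hull) convex"]) auto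

end

theorem theorem7p13:
  fixes \<Phi> \<Delta> J :: "'a::euclidean_space set"
    and u v :: "'a \<Rightarrow> 'a"
    and F :: "'a set"
  assumes "root_system \<Phi>" and "simple_roots \<Phi> \<Delta>" and "J \<subseteq> \<Delta>"
    and "u \<in> weyl_group \<Phi>" and "v \<in> min_coset_reps \<Phi> \<Delta> J" and "bruhat_le \<Phi> \<Delta> u v"
    and "F face_of bruhat_interval_polytope \<Phi> \<Delta> J u v" and "F \<noteq> {}"
  shows "\<exists>a\<in>weyl_group \<Phi>. \<exists>b\<in>min_coset_reps \<Phi> \<Delta> J.
           bruhat_le \<Phi> \<Delta> a b \<and> F = bruhat_interval_polytope \<Phi> \<Delta> J a b"
proof -
  interpret based_root_system \<Phi> \<Delta>
    by (rule based_root_system.intro[OF assms(1,2)])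
  obtain a b where ab: "le a b" "F = convex hull ((\<lambda>z. z (parabolic_rho \<Delta> J)) ` ivl a b)"
    using face_eq_hull_interval[OF dominant_parabolic_rho assms(6)] assms(7,8)
    unfolding bruhat_interval_polytope_eq by blast
  obtain a' b' where "le a' b'" "b' \<in> min_coset_reps \<Phi> \<Delta> J"
    "(\<lambda>z. z (parabolic_rho \<Delta> J)) ` ivl a' b' = (\<lambda>z. z (parabolic_rho \<Delta> J)) ` ivl a b"
    using interval_image_min_coset_rep[OF assms(3) ab(1)] by blast
  then show ?thesis
    using ab(2) le_weyl(1) unfolding bruhat_interval_polytope_eq by metis
qed

end
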